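(* Let $n \geq 5$ be an integer. Every $n \times n$ matrix $M$ with all entries in $\{-1,1\}$ that is not split and satisfies $|\operatorname{disc}(M)| \leq n^2/4$ contains a zero-sum square.
   Context: Let $M = (a_{i,j})_{1 \le i \le n,\, 1 \le j \le m}$ be an $n \times m$ matrix. Discrepancy: $\operatorname{disc}(M) = \sum_{1 \leq i \leq n,\ 1 \leq j \leq m} a_{i,j}$, the sum of all entries. Square: a square in $M$ is a $2 \times 2$ submatrix with entries $a_{i,j},\ a_{i,j+s},\ a_{i+s,j},\ a_{i+s,j+s}$ for some $s \geq 1$ (with all indices in range, i.e. $1 \le i < i+s \le n$ and $1 \le j < j+s \le m$). It is a zero-sum square if $a_{i,j} + a_{i,j+s} + a_{i+s,j} + a_{i+s,j+s} = 0$. $t$-split: for an integer $0 \leq t \leq n+m-1$, an $n \times m$ $\{-1,1\}$-matrix $(a_{i,j})$ is $t$-split if for all $i,j$ one has $a_{i,j} = 1$ when $i + j \leq t+1$ and $a_{i,j} = -1$ when $i + j \geq t+2$. Split: a matrix $M$ is split if there is some $t$ such that a $t$-split matrix can be obtained from $M$ by applying vertical and horizontal reflections (i.e. by possibly reversing the order of the rows and possibly reversing the order of the columns). *)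

theory Defs
  imports Complex_Main "Jordan_Normal_Form.Matrix"
begin

text \<open>
  Matrix indices start at 0 here: the entry in row \<open>i\<close> and column \<open>j\<close> of the usual
  1-based convention is \<open>M $$ (i - 1, j - 1)\<close>.
\<close>

definition disc :: "int mat \<Rightarrow> int" where
  "disc M = (\<Sum>i<dim_row M. \<Sum>j<dim_col M. M $$ (i, j))"

definition square_at :: "int mat \<Rightarrow> nat \<Rightarrow> nat \<Rightarrow> nat \<Rightarrow> bool" where
  "square_at M i j s \<longleftrightarrow> s \<ge> 1 \<and> i + s < dim_row M \<and> j + s < dim_col M"

definition zero_sum_square_at :: "int mat \<Rightarrow> nat \<Rightarrow> nat \<Rightarrow> nat \<Rightarrow> bool" where
  "zero_sum_square_at M i j s \<longleftrightarrow> square_at M i j s \<and>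
     M $$ (i, j) + M $$ (i, j + s) + M $$ (i + s, j) + M $$ (i + s, j + s) = 0"

text \<open>
  The bound \<open>0 \<le> t \<le> n + m - 1\<close> is written without truncated subtraction, and \<open>i + 1\<close>,
  \<open>j + 1\<close> are the 1-based positions. The two cases are exhaustive, so all entries of a
  \<open>t\<close>-split matrix lie in \<open>{-1, 1}\<close>.
\<close>

definition t_split :: "nat \<Rightarrow> int mat \<Rightarrow> bool" where
  "t_split t M \<longleftrightarrow> t + 1 \<le> dim_row M + dim_col M \<and>
     (\<forall>i<dim_row M. \<forall>j<dim_col M.
        ((i + 1) + (j + 1) \<le> t + 1 \<longrightarrow> M $$ (i, j) = 1) \<and>
        ((i + 1) + (j + 1) \<ge> t + 2 \<longrightarrow> M $$ (i, j) = -1))"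

definition reverse_rows :: "int mat \<Rightarrow> int mat" where
  "reverse_rows M =
     mat (dim_row M) (dim_col M) (\<lambda>(i, j). M $$ (dim_row M - 1 - i, j))"

definition reverse_cols :: "int mat \<Rightarrow> int mat" where
  "reverse_cols M =
     mat (dim_row M) (dim_col M) (\<lambda>(i, j). M $$ (i, dim_col M - 1 - j))"

definition split_mat :: "int mat \<Rightarrow> bool" where
  "split_mat M \<longleftrightarrow>
     (\<exists>t. \<exists>N \<in> {M, reverse_rows M, reverse_cols M, reverse_rows (reverse_cols M)}. t_split t N)"

end

theory Submission
  imports Defs
begin

text \<open>
  The proof compares blocks: submatrices on consecutive rows and consecutive columns. Everything is
  controlled by the \<open>5 \<times> 5\<close> blocks of a matrix without zero-sum squares. An exhaustive search over
  such matrices with five rows (\<open>search_7\<close>) yields two facts. A \<open>5 \<times> 5\<close> matrix with discrepancy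
  less than 7 in absolute value is, up to negation and reflection, a staircase, that is, the
  \<open>t\<close>-split matrix with \<open>t = 4\<close> or \<open>t = 5\<close> (\<open>low_5x5_staircase\<close>). And if every \<open>5 \<times> 5\<close> block
  has discrepancy at most \<open>-7\<close>, then so many entries are \<open>-1\<close> that strips of four rows have
  discrepancy at most minus a quarter of their area (\<open>negative_strip\<close>).

  Suppose first that no \<open>5 \<times> 5\<close> block is low, that is, all have discrepancy at least 7 in absolute
  value. Moving a block by one step changes its discrepancy by at most 10, so all blocks have the same
  sign, and up to negation all are at most \<open>-7\<close>. Cutting off hooks made of the last four rows
  and columns then reduces the size by 4 at a time, down to sizes 5 to 8, and gives a discrepancy
  below \<open>-n\<^sup>2/4\<close> (\<open>negative_bound\<close>).

  Suppose now that some block is low, hence a staircase. The pattern is forced to continue along its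
  antidiagonal until it reaches two sides of the matrix (\<open>grow_to_corner\<close>); after a reflection
  and possibly a negation it fills the top left corner, with \<open>+1\<close> in a triangle of side \<open>t\<close>
  and \<open>-1\<close> beyond it. The region of \<open>-1\<close> is forced further, up to the
  corner square of size \<open>m = \<lfloor>3t/2\<rfloor>\<close> (\<open>extend\<close>), so a matrix that is not split has
  \<open>m < n\<close>. In that square the triangle is already so small that the discrepancy is below
  \<open>-m\<^sup>2/4\<close>. It remains to see that the rest of the matrix cannot make up for this. Staircases in
  two different corners produce a zero-sum square (\<open>no_facing_corners\<close>, \<open>no_opposite_corners\<close>),
  except for opposite corners of opposite sign; the latter are excluded because moving a negative
  block down or to the right never leads into a staircase that starts with \<open>+1\<close>. So all blocks
  outside the triangle have discrepancy at most \<open>-7\<close> (\<open>negative_outside\<close>), and adding hooks of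
  width four to the corner square shows that the discrepancy of the whole matrix is below
  \<open>-n\<^sup>2/4\<close> (\<open>corner_bound\<close>).
\<close>

section \<open>Sign matrices\<close>

definition sg :: "bool \<Rightarrow> int" where
  "sg b = (if b then 1 else -1)"

text \<open>
  Exactly two of the four entries are 1, see \<open>zero_sum_iff_sum\<close>. In this form the condition is cheap to
  evaluate in the search below.
\<close>
definition zero_sum :: "bool \<Rightarrow> bool \<Rightarrow> bool \<Rightarrow> bool \<Rightarrow> bool" where
  "zero_sum a b c d \<longleftrightarrow> (if a = b then c = d \<and> c \<noteq> a else c \<noteq> d)"

lemma zero_sum_iff_sum: "zero_sum a b c d \<longleftrightarrow> sg a + sg b + sg c + sg d = 0"
  by (simp add: zero_sum_def sg_def)

lemma zero_sum_iff: "zero_sum a b c d \<longleftrightarrow> a = b \<and> c = d \<and> c \<noteq> a \<or> a \<noteq> b \<and> c \<noteq> d"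
  by (simp add: zero_sum_def)

text \<open>
  A matrix is represented by a total function, with \<open>True\<close> for the entry 1. Its size is
  an argument of each notion, so that blocks are obtained by shifting the origin.
\<close>
type_synonym sign_matrix = "nat \<Rightarrow> nat \<Rightarrow> bool"

definition square_free :: "nat \<Rightarrow> nat \<Rightarrow> sign_matrix \<Rightarrow> bool" where
  "square_free n m f \<longleftrightarrow> (\<forall>i j s. 1 \<le> s \<and> i + s < n \<and> j + s < m \<longrightarrow>
     \<not> zero_sum (f i j) (f i (j + s)) (f (i + s) j) (f (i + s) (j + s)))"

definition block_disc :: "nat \<Rightarrow> nat \<Rightarrow> sign_matrix \<Rightarrow> int" where
  "block_disc n m f = (\<Sum>i<n. \<Sum>j<m. sg (f i j))"

definition shift :: "nat \<Rightarrow> nat \<Rightarrow> sign_matrix \<Rightarrow> sign_matrix" where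
  "shift r c f = (\<lambda>i j. f (r + i) (c + j))"

definition transposed :: "sign_matrix \<Rightarrow> sign_matrix" where
  "transposed f = (\<lambda>i j. f j i)"

definition negated :: "sign_matrix \<Rightarrow> sign_matrix" where
  "negated f = (\<lambda>i j. \<not> f i j)"

definition flip_rows :: "nat \<Rightarrow> sign_matrix \<Rightarrow> sign_matrix" where
  "flip_rows n f = (\<lambda>i j. f (n - 1 - i) j)"

definition flip_cols :: "nat \<Rightarrow> sign_matrix \<Rightarrow> sign_matrix" where
  "flip_cols m f = (\<lambda>i j. f i (m - 1 - j))"

text \<open>
  The \<open>t\<close>-split pattern on the top left \<open>k \<times> k\<close> square; \<open>t\<close> is the side of the triangle of ones,
  and \<open>t \<ge> 2 * k - 1\<close> means that all entries are ones.
\<close>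
definition staircase :: "nat \<Rightarrow> nat \<Rightarrow> sign_matrix \<Rightarrow> bool" where
  "staircase k t f \<longleftrightarrow> (\<forall>i<k. \<forall>j<k. f i j = (i + j < t))"

lemma square_freeD:
  assumes "square_free n m f" "i < i'" "i' < n" "j < m" "j' < m" "j' = j + (i' - i)"
  shows "\<not> zero_sum (f i j) (f i j') (f i' j) (f i' j')"
proof -
  have "1 \<le> i' - i \<and> i + (i' - i) < n \<and> j + (i' - i) < m" using assms by simp
  then have "\<not> zero_sum (f i j) (f i (j + (i' - i))) (f (i + (i' - i)) j) (f (i + (i' - i)) (j + (i' - i)))"
    using assms(1) unfolding square_free_def by blast
  then show ?thesis using assms by simp
qed

lemma square_freeI:
  assumes "\<And>i i' j j'. i < i' \<Longrightarrow> i' < n \<Longrightarrow> j < j' \<Longrightarrow> j' < m \<Longrightarrow> j' - j = i' - i \<Longrightarrow>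
    \<not> zero_sum (f i j) (f i j') (f i' j) (f i' j')"
  shows "square_free n m f"
  unfolding square_free_def
proof (intro allI impI)
  fix i j s :: nat assume "1 \<le> s \<and> i + s < n \<and> j + s < m"
  then show "\<not> zero_sum (f i j) (f i (j + s)) (f (i + s) j) (f (i + s) (j + s))"
    using assms[of i "i + s" j "j + s"] by simp
qed

lemma staircaseD: "staircase k t f \<Longrightarrow> i < k \<Longrightarrow> j < k \<Longrightarrow> f i j = (i + j < t)"
  by (simp add: staircase_def)

lemma staircase_mono: "staircase k t f \<Longrightarrow> l \<le> k \<Longrightarrow> staircase l t f"
  by (simp add: staircase_def)

lemma square_free_shift:
  assumes "square_free n m f" "r + a \<le> n" "c + b \<le> m"
  shows "square_free a b (shift r c f)"
proof (rule square_freeI)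
  fix i i' j j' assume h: "i < i'" "i' < a" "j < j'" "j' < b" "j' - j = i' - i"
  show "\<not> zero_sum (shift r c f i j) (shift r c f i j') (shift r c f i' j) (shift r c f i' j')"
    unfolding shift_def by (rule square_freeD[OF assms(1)]) (use h assms in auto)
qed

lemma zero_sum_swap: "zero_sum a b c d = zero_sum b a d c" "zero_sum a b c d = zero_sum c d a b" "zero_sum a b c d = zero_sum a c b d"
  "zero_sum (\<not> a) (\<not> b) (\<not> c) (\<not> d) = zero_sum a b c d"
  by (auto simp: zero_sum_def)

lemma square_free_transposed: "square_free n m f \<Longrightarrow> square_free m n (transposed f)"
  by (rule square_freeI, unfold transposed_def, subst zero_sum_swap(3), rule square_freeD, assumption) auto

lemma square_free_negated: "square_free n m f \<Longrightarrow> square_free n m (negated f)"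
  by (rule square_freeI, unfold negated_def, subst zero_sum_swap(4), rule square_freeD, assumption) auto

lemma square_free_flip_cols: "square_free n m f \<Longrightarrow> square_free n m (flip_cols m f)"
  by (rule square_freeI, unfold flip_cols_def, subst zero_sum_swap(1), rule square_freeD, assumption) auto

lemma square_free_flip_rows: "square_free n m f \<Longrightarrow> square_free n m (flip_rows n f)"
  by (rule square_freeI, unfold flip_rows_def, subst zero_sum_swap(2), rule square_freeD, assumption) auto

lemma sum_lessThan_add: "(\<Sum>i<a + b. g i) = (\<Sum>i<a. g i) + (\<Sum>i<b. g (a + i :: nat) :: int)"
  by (induction b) (simp_all add: add.assoc)

lemma block_disc_rows: "block_disc (a + a') b f = block_disc a b f + block_disc a' b (shift a 0 f)"
  by (simp add: block_disc_def shift_def sum_lessThan_add)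

lemma block_disc_cols: "block_disc a (b + b') f = block_disc a b f + block_disc a b' (shift 0 b f)"
  by (simp add: block_disc_def shift_def sum_lessThan_add sum.distrib)

lemma block_disc_transposed: "block_disc b a (transposed f) = block_disc a b f"
  unfolding block_disc_def transposed_def by (rule sum.swap)

lemma block_disc_negated: "block_disc a b (negated f) = - block_disc a b f"
proof -
  have "sg (\<not> b) = - sg b" for b by (simp add: sg_def)
  then show ?thesis by (simp add: block_disc_def negated_def sum_negf)
qed

lemma block_disc_flip_cols: "block_disc a b (flip_cols b f) = block_disc a b f"
proof -
  have "(\<Sum>j<b. sg (f i (b - 1 - j))) = (\<Sum>j<b. sg (f i j))" for i
    using sum.nat_diff_reindex[of "\<lambda>j. sg (f i j)" b] by simp
  then show ?thesis by (simp add: block_disc_def flip_cols_def)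
qed

lemma block_disc_flip_rows: "block_disc a b (flip_rows a f) = block_disc a b f"
  unfolding block_disc_def flip_rows_def
  using sum.nat_diff_reindex[of "\<lambda>i. \<Sum>j<b. sg (f i j)" a] by simp

lemma block_disc_le: "block_disc a b f \<le> int a * int b"
proof -
  have "(\<Sum>i<a. \<Sum>j<b. sg (f i j)) \<le> (\<Sum>i<a. \<Sum>j<b. 1)"
    by (intro sum_mono) (simp add: sg_def)
  then show ?thesis by (simp add: block_disc_def)
qed

lemma shift_shift: "shift r c (shift r' c' f) = shift (r' + r) (c' + c) f"
  by (simp add: shift_def add.assoc)

lemma shift_0: "shift 0 0 f = f" by (simp add: shift_def)

lemma transposed_shift: "transposed (shift r c f) = shift c r (transposed f)" by (simp add: transposed_def shift_def)

text \<open>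
  The search shows that the discrepancy of a square-free \<open>5 \<times> 5\<close> block that is not a staircase is
  at least 7 in absolute value, which explains the bound \<open>-7\<close>.
\<close>
definition negative :: "nat \<Rightarrow> nat \<Rightarrow> sign_matrix \<Rightarrow> bool" where
  "negative n m f \<longleftrightarrow> square_free n m f \<and>
     (\<forall>r c. r + 5 \<le> n \<longrightarrow> c + 5 \<le> m \<longrightarrow> block_disc 5 5 (shift r c f) \<le> -7)"

lemma negative_shift:
  assumes "negative n m f" "r + a \<le> n" "c + b \<le> m"
  shows "negative a b (shift r c f)"
  using assms square_free_shift[of n m f r a c b] by (auto simp: negative_def shift_shift)

section \<open>Exhaustive search on matrices with five rows\<close>

text \<open>
  The search builds a square-free matrix with five rows column by column. Partial matrices are lists
  of columns with the newest column first. Squares of side 1 determine most of the new column from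
  the previous one, so new columns are generated from top to bottom by \<open>next_entries\<close>, the entries that
  avoid a zero-sum square with the entry above and the two entries to the left. Squares of larger side
  are tested afterwards by \<open>fits\<close>. Conditionals take the place of conjunctions since
  evaluation by rewriting does not evaluate the branches of a conditional in advance.
\<close>
datatype col = Col bool bool bool bool bool

definition next_entries :: "bool \<Rightarrow> bool \<Rightarrow> bool \<Rightarrow> bool list" where
  "next_entries a b a' = (if a = b then (if a' = a then [True, False] else [a]) else [a'])"

fun next_cols :: "col \<Rightarrow> col list" where
  "next_cols (Col a b c d e) =
    concat (map (\<lambda>a'. concat (map (\<lambda>b'. concat (map (\<lambda>c'. concat (map (\<lambda>d'.
      map (\<lambda>e'. Col a' b' c' d' e') (next_entries d e d')) (next_entries c d c'))) (next_entries b c b'))) (next_entries a b a'))) [True, False])"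

definition all_cols :: "col list" where
  "all_cols =
    concat (map (\<lambda>a. concat (map (\<lambda>b. concat (map (\<lambda>c. concat (map (\<lambda>d.
      map (\<lambda>e. Col a b c d e) [True, False]) [True, False])) [True, False])) [True, False])) [True, False])"

fun candidates :: "col list \<Rightarrow> col list" where
  "candidates [] = all_cols"
| "candidates (p # ps) = next_cols p"

fun ok2 :: "col \<Rightarrow> col \<Rightarrow> bool" where
  "ok2 (Col a b c d e) (Col a' b' c' d' e') =
     (if zero_sum a c a' c' then False else if zero_sum b d b' d' then False else \<not> zero_sum c e c' e')"

fun ok3 :: "col \<Rightarrow> col \<Rightarrow> bool" where
  "ok3 (Col a b c d e) (Col a' b' c' d' e') =
     (if zero_sum a d a' d' then False else \<not> zero_sum b e b' e')"

fun ok4 :: "col \<Rightarrow> col \<Rightarrow> bool" where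
  "ok4 (Col a b c d e) (Col a' b' c' d' e') = (\<not> zero_sum a e a' e')"

fun fits :: "col list \<Rightarrow> col \<Rightarrow> bool" where
  "fits (p # q # r # s # t) c = (if ok2 q c then if ok3 r c then ok4 s c else False else False)"
| "fits [p, q, r] c = (if ok2 q c then ok3 r c else False)"
| "fits [p, q] c = ok2 q c"
| "fits _ c = True"

fun cdisc :: "col \<Rightarrow> int" where "cdisc (Col a b c d e) = sg a + sg b + sg c + sg d + sg e"
fun cdisc_lower4 :: "col \<Rightarrow> int" where "cdisc_lower4 (Col a b c d e) = sg b + sg c + sg d + sg e"
fun cdisc_upper3 :: "col \<Rightarrow> int" where "cdisc_upper3 (Col a b c d e) = sg a + sg b + sg c"
fun cdisc_upper2 :: "col \<Rightarrow> int" where "cdisc_upper2 (Col a b c d e) = sg a + sg b"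

fun last_negative :: "col list \<Rightarrow> bool" where
  "last_negative (p # q # r # s # t # u) = (cdisc p + cdisc q + cdisc r + cdisc s + cdisc t \<le> -7)"
| "last_negative _ = True"

text \<open>
  The staircases with \<open>t = 5\<close> and \<open>t = 4\<close>, columns from right to left.
\<close>
definition stair_cols :: "col list list" where
  "stair_cols =
    [[Col True False False False False, Col True True False False False,
      Col True True True False False, Col True True True True False, Col True True True True True],
     [Col False False False False False, Col True False False False False,
      Col True True False False False, Col True True True False False, Col True True True True False]]"

fun neg_col :: "col \<Rightarrow> col" where
  "neg_col (Col a b c d e) = Col (\<not> a) (\<not> b) (\<not> c) (\<not> d) (\<not> e)"

definition all_stair_cols :: "col list list" where
  "all_stair_cols = stair_cols @ map rev stair_cols @ map (map neg_col) stair_cols @ map (map neg_col) (map rev stair_cols)"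

text \<open>
  What is to be verified: a matrix of width 5 and low discrepancy is a staircase, and a matrix of
  width 5, 6 or 7 satisfies the given bounds if its last \<open>5 \<times> 5\<close> block has discrepancy at most
  \<open>-7\<close>; the search makes sure that the earlier blocks have. The bounds for four
  rows concern the lower four of the five rows: they serve to bound a strip whose blocks include the row
  above it.
\<close>
fun admissible :: "col list \<Rightarrow> bool" where
  "admissible [p, q, r, s, t] =
    (if cdisc p + cdisc q + cdisc r + cdisc s + cdisc t \<le> -7 then
       cdisc_lower4 p + cdisc_lower4 q + cdisc_lower4 r + cdisc_lower4 s \<le> -4 \<and>
       cdisc_lower4 p + cdisc_lower4 q + cdisc_lower4 r + cdisc_lower4 s + cdisc_lower4 t \<le> -6 \<and>
       cdisc_lower4 p \<le> 2
     else if cdisc p + cdisc q + cdisc r + cdisc s + cdisc t \<ge> 7 then True else [p, q, r, s, t] \<in> set all_stair_cols)"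
| "admissible [p, q, r, s, t, u] =
    (if cdisc p + cdisc q + cdisc r + cdisc s + cdisc t \<le> -7 then
       cdisc_lower4 p + cdisc_lower4 q + cdisc_lower4 r + cdisc_lower4 s + cdisc_lower4 t + cdisc_lower4 u \<le> -10 \<and>
       cdisc_upper3 p + cdisc_upper3 q + cdisc_upper3 r + cdisc_upper3 s + cdisc_upper3 t + cdisc_upper3 u \<le> -4 \<and>
       cdisc_upper2 p + cdisc_upper2 q + cdisc_upper2 r + cdisc_upper2 s + cdisc_upper2 t + cdisc_upper2 u \<le> 0
     else True)"
| "admissible [p, q, r, s, t, u, v] =
    (if cdisc p + cdisc q + cdisc r + cdisc s + cdisc t \<le> -7 then
       cdisc_lower4 p + cdisc_lower4 q + cdisc_lower4 r + cdisc_lower4 s + cdisc_lower4 t + cdisc_lower4 u + cdisc_lower4 v \<le> -12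
     else True)"
| "admissible _ = True"

text \<open>
  Matrices are extended only while their last \<open>5 \<times> 5\<close> block is negative. About two thousand
  matrices of width 6 remain, so that the evaluation in \<open>search_7\<close> is feasible.
\<close>
fun search :: "nat \<Rightarrow> col list \<Rightarrow> bool" where
  "search 0 ps = True"
| "search (Suc k) ps = list_all (\<lambda>c. if fits ps c then
       (if admissible (c # ps) then if last_negative (c # ps) then search k (c # ps) else True else False)
     else True) (candidates ps)"

lemma search_7: "search (Suc (Suc (Suc (Suc (Suc (Suc (Suc 0))))))) []"
  by code_simp

definition column :: "sign_matrix \<Rightarrow> nat \<Rightarrow> col" where
  "column f j = Col (f 0 j) (f 1 j) (f 2 j) (f 3 j) (f 4 j)"

fun cols :: "sign_matrix \<Rightarrow> nat \<Rightarrow> col list" where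
  "cols f 0 = []"
| "cols f (Suc w) = column f w # cols f w"

lemma in_next_entries: "b' \<in> set (next_entries a b a') \<longleftrightarrow> \<not> zero_sum a b a' b'"
  by (auto simp: next_entries_def zero_sum_def)

lemma in_all_cols: "c \<in> set all_cols"
proof (cases c)
  case (Col p q r s t)
  then show ?thesis
    by (cases p; cases q; cases r; cases s; cases t) (simp_all add: all_cols_def)
qed

lemma square_free_col:
  assumes "square_free 5 w f" "j < j'" "j' < w" "i < i'" "i' < 5" "i' - i = j' - j"
  shows "\<not> zero_sum (f i j) (f i' j) (f i j') (f i' j')"
  by (subst zero_sum_swap(3), rule square_freeD[OF assms(1,4,5)]) (use assms in auto)

lemma in_next_cols:
  assumes "\<not> zero_sum a b a' b'" "\<not> zero_sum b c b' c'" "\<not> zero_sum c d c' d'" "\<not> zero_sum d e d' e'"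
  shows "Col a' b' c' d' e' \<in> set (next_cols (Col a b c d e))"
proof -
  have m: "y \<in> set (concat (map g xs))" if "x \<in> set xs" "y \<in> set (g x)" for x xs g and y :: col
    using that by auto
  have "a' \<in> set [True, False]" by simp
  note assms[folded in_next_entries]
  then show ?thesis
    unfolding next_cols.simps by (intro m[OF \<open>a' \<in> _\<close>] m[of b'] m[of c'] m[of d']) simp_all
qed

lemma column_in_candidates:
  assumes "square_free 5 (Suc w) f"
  shows "column f w \<in> set (candidates (cols f w))"
proof (cases w)
  case 0 then show ?thesis by (simp add: in_all_cols)
next
  case (Suc v)
  have "\<not> zero_sum (f i v) (f (Suc i) v) (f i w) (f (Suc i) w)" if "i < 4" for i
    by (rule square_free_col[OF assms]) (use that Suc in auto)
  from this[of 0] this[of 1] this[of 2] this[of 3] show ?thesis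
    using Suc by (simp add: column_def in_next_cols numeral_eq_Suc del: next_cols.simps)
qed

lemma column_fits:
  assumes "square_free 5 (Suc w) f"
  shows "fits (cols f w) (column f w)"
proof -
  have z: "\<not> zero_sum (f i j) (f i' j) (f i w) (f i' w)" if "i < i'" "i' < 5" "j + (i' - i) = w" for i i' j
    by (rule square_free_col[OF assms]) (use that in auto)
  consider "w = 0" | "w = 1" | "w = 2" | "w = 3" | v where "w = Suc (Suc (Suc (Suc v)))"
    by (metis One_nat_def Suc_1 not0_implies_Suc numeral_3_eq_3)
  then show ?thesis
  proof cases
    case 3 
    then show ?thesis using z[of 0 2 0] z[of 1 3 0] z[of 2 4 0] by (simp add: column_def numeral_eq_Suc)
  next
    case 4
    then show ?thesis using z[of 0 2 1] z[of 1 3 1] z[of 2 4 1] z[of 0 3 0] z[of 1 4 0] by (simp add: column_def numeral_eq_Suc)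
  next
    case (5 v)
    then show ?thesis using z[of 0 2 "Suc (Suc v)"] z[of 1 3 "Suc (Suc v)"] z[of 2 4 "Suc (Suc v)"]
       z[of 0 3 "Suc v"] z[of 1 4 "Suc v"] z[of 0 4 v] by (simp add: column_def numeral_eq_Suc)
  qed (simp_all add: numeral_eq_Suc)
qed

text \<open>
  The columns of a square-free matrix form one of the branches that the search explores.
\<close>
lemma search_sound:
  assumes "search k (cols f w)" "square_free 5 (w + l) f" "0 < l" "l \<le> k"
    and "\<And>v. w < v \<Longrightarrow> v < w + l \<Longrightarrow> last_negative (cols f v)"
  shows "admissible (cols f (w + l))"
  using assms
proof (induction k arbitrary: w l)
  case 0 then show ?case by simp
next
  case (Suc k)
  have s: "square_free 5 (Suc w) f" using square_free_shift[OF Suc.prems(2), of 0 5 0 "Suc w"] Suc.prems(3) by (simp add: shift_0)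
  have a: "admissible (cols f (Suc w)) \<and> (last_negative (cols f (Suc w)) \<longrightarrow> search k (cols f (Suc w)))"
    using Suc.prems(1) column_in_candidates[OF s] column_fits[OF s]
    by (auto simp: list_all_iff split: if_splits)
  show ?case
  proof (cases "l = 1")
    case True with a show ?thesis by simp
  next
    case False
    then have "last_negative (cols f (Suc w))" using Suc.prems(3) by (intro Suc.prems(5)) auto
    then have "admissible (cols f (Suc w + (l - 1)))"
      using a False Suc.prems by (intro Suc.IH) auto
    then show ?thesis using Suc.prems(3) by simp
  qed
qed

lemma admissible_cols:
  assumes "square_free 5 w f" "0 < w" "w \<le> 7" "\<And>v. v < w \<Longrightarrow> last_negative (cols f v)"
  shows "admissible (cols f w)"
  using search_sound[of 7 f 0 w] search_7 assms by (simp add: numeral_eq_Suc)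

lemma block_disc_unfold:
  "block_disc 5 5 f = cdisc (column f 4) + cdisc (column f 3) + cdisc (column f 2) + cdisc (column f 1) + cdisc (column f 0)"
  by (simp add: block_disc_def column_def numeral_eq_Suc)

lemma last_negative_cols:
  assumes "\<And>c. c + 5 \<le> v \<Longrightarrow> block_disc 5 5 (shift 0 c f) \<le> -7"
  shows "last_negative (cols f v)"
proof (cases "v < 5")
  case True
  then have "v = 0 \<or> v = 1 \<or> v = 2 \<or> v = 3 \<or> v = 4" by auto
  then show ?thesis by (auto simp: numeral_eq_Suc)
next
  case False
  then obtain c where "v = 5 + c"
    using le_Suc_ex linorder_not_less by blast
  then have v: "v = Suc (Suc (Suc (Suc (Suc c))))" by simp
  show ?thesis using assms[of c] v by (simp add: block_disc_unfold) (simp add: column_def shift_def numeral_eq_Suc)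
qed

lemma negative_admissible:
  assumes "negative 5 w f" "0 < w" "w \<le> 7"
  shows "admissible (cols f w)"
proof (rule admissible_cols)
  show "square_free 5 w f" using assms by (simp add: negative_def)
  show "last_negative (cols f v)" if "v < w" for v
    using assms(1) that by (intro last_negative_cols) (auto simp: negative_def)
qed (use assms in auto)

text \<open>
  In each of the next three lemmas the last \<open>5 \<times> 5\<close> block satisfies the guard in the definition of
  \<open>admissible\<close>, so that the listed bounds are available. They are translated back into
  discrepancies of blocks, with \<open>shift 1 0\<close> dropping the first row.
\<close>

lemma negative_5x5:
  assumes "negative 5 5 f"
  shows "block_disc 5 5 f \<le> -7" "block_disc 4 4 (shift 1 1 f) \<le> -4"
    "block_disc 4 5 (shift 1 0 f) \<le> -6" "block_disc 4 1 (shift 1 4 f) \<le> 2"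
proof -
  let ?c = "column f"
  have "block_disc 5 5 (shift 0 0 f) \<le> -7" using assms unfolding negative_def by auto
  then show *: "block_disc 5 5 f \<le> -7" by (simp add: shift_0)
  have "admissible [?c 4, ?c 3, ?c 2, ?c 1, ?c 0]"
    using negative_admissible[OF assms] by (simp add: numeral_eq_Suc)
  then have g: "cdisc_lower4 (?c 4) + cdisc_lower4 (?c 3) + cdisc_lower4 (?c 2) + cdisc_lower4 (?c 1) \<le> -4"
    "cdisc_lower4 (?c 4) + cdisc_lower4 (?c 3) + cdisc_lower4 (?c 2) + cdisc_lower4 (?c 1) + cdisc_lower4 (?c 0) \<le> -6"
    "cdisc_lower4 (?c 4) \<le> 2"
    using * unfolding block_disc_unfold by simp_all
  show "block_disc 4 4 (shift 1 1 f) \<le> -4" using g(1)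
    by (simp add: block_disc_def column_def shift_def numeral_eq_Suc)
  show "block_disc 4 5 (shift 1 0 f) \<le> -6" using g(2)
    by (simp add: block_disc_def column_def shift_def numeral_eq_Suc)
  show "block_disc 4 1 (shift 1 4 f) \<le> 2" using g(3)
    by (simp add: block_disc_def column_def shift_def numeral_eq_Suc)
qed

lemma negative_5x6:
  assumes "negative 5 6 f"
  shows "block_disc 4 6 (shift 1 0 f) \<le> -10" "block_disc 3 6 f \<le> -4" "block_disc 2 6 f \<le> 0"
proof -
  let ?c = "column f"
  have "block_disc 5 5 (shift 0 1 f) \<le> -7" using assms unfolding negative_def by auto
  moreover have "column (shift 0 1 f) j = ?c (Suc j)" for j by (simp add: column_def shift_def)
  ultimately have "cdisc (?c 5) + cdisc (?c 4) + cdisc (?c 3) + cdisc (?c 2) + cdisc (?c 1) \<le> -7"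
    unfolding block_disc_unfold by (simp add: eval_nat_numeral)
  moreover have "admissible [?c 5, ?c 4, ?c 3, ?c 2, ?c 1, ?c 0]"
    using negative_admissible[OF assms] by (simp add: numeral_eq_Suc)
  ultimately have g:
    "cdisc_lower4 (?c 5) + cdisc_lower4 (?c 4) + cdisc_lower4 (?c 3) + cdisc_lower4 (?c 2) + cdisc_lower4 (?c 1) + cdisc_lower4 (?c 0) \<le> -10"
    "cdisc_upper3 (?c 5) + cdisc_upper3 (?c 4) + cdisc_upper3 (?c 3) + cdisc_upper3 (?c 2) + cdisc_upper3 (?c 1) + cdisc_upper3 (?c 0) \<le> -4"
    "cdisc_upper2 (?c 5) + cdisc_upper2 (?c 4) + cdisc_upper2 (?c 3) + cdisc_upper2 (?c 2) + cdisc_upper2 (?c 1) + cdisc_upper2 (?c 0) \<le> 0"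
    by simp_all
  show "block_disc 4 6 (shift 1 0 f) \<le> -10" using g(1)
    by (simp add: block_disc_def column_def shift_def numeral_eq_Suc)
  show "block_disc 3 6 f \<le> -4" using g(2)
    by (simp add: block_disc_def column_def shift_def numeral_eq_Suc)
  show "block_disc 2 6 f \<le> 0" using g(3)
    by (simp add: block_disc_def column_def shift_def numeral_eq_Suc)
qed

lemma negative_5x7:
  assumes "negative 5 7 f"
  shows "block_disc 4 7 (shift 1 0 f) \<le> -12"
proof -
  let ?c = "column f"
  have "block_disc 5 5 (shift 0 2 f) \<le> -7" using assms unfolding negative_def by auto
  moreover have "column (shift 0 2 f) j = ?c (Suc (Suc j))" for j by (simp add: column_def shift_def)
  ultimately have "cdisc (?c 6) + cdisc (?c 5) + cdisc (?c 4) + cdisc (?c 3) + cdisc (?c 2) \<le> -7"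
    unfolding block_disc_unfold by (simp add: eval_nat_numeral)
  moreover have "admissible [?c 6, ?c 5, ?c 4, ?c 3, ?c 2, ?c 1, ?c 0]"
    using negative_admissible[OF assms] by (simp add: numeral_eq_Suc)
  ultimately have "cdisc_lower4 (?c 6) + cdisc_lower4 (?c 5) + cdisc_lower4 (?c 4) + cdisc_lower4 (?c 3)
      + cdisc_lower4 (?c 2) + cdisc_lower4 (?c 1) + cdisc_lower4 (?c 0) \<le> -12"
    by simp
  then show ?thesis
    by (simp add: block_disc_def column_def shift_def numeral_eq_Suc)
qed

lemma staircase_5_iff:
  "staircase 5 5 f \<longleftrightarrow> [column f 4, column f 3, column f 2, column f 1, column f 0] = stair_cols ! 0"
  "staircase 5 4 f \<longleftrightarrow> [column f 4, column f 3, column f 2, column f 1, column f 0] = stair_cols ! 1"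
proof -
  have *: "(\<forall>i<5. P i) \<longleftrightarrow> P 0 \<and> P 1 \<and> P 2 \<and> P 3 \<and> P 4" for P :: "nat \<Rightarrow> bool"
  proof -
    have "i < 5 \<longleftrightarrow> i = 0 \<or> i = 1 \<or> i = 2 \<or> i = 3 \<or> i = 4" for i :: nat by linarith
    then show ?thesis by metis
  qed
  show "staircase 5 5 f \<longleftrightarrow> [column f 4, column f 3, column f 2, column f 1, column f 0] = stair_cols ! 0"
    unfolding staircase_def * by (simp add: stair_cols_def column_def) (safe; assumption)
  show "staircase 5 4 f \<longleftrightarrow> [column f 4, column f 3, column f 2, column f 1, column f 0] = stair_cols ! 1"
    unfolding staircase_def * by (simp add: stair_cols_def column_def) (safe; assumption)
qed

text \<open>
  The only square-free \<open>5 \<times> 5\<close> matrices of small discrepancy that the search meets are the eight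
  symmetric images of two staircases.
\<close>
lemma low_5x5_staircase:
  assumes "square_free 5 5 f" "\<bar>block_disc 5 5 f\<bar> < 7"
  shows "\<exists>h\<in>{f, negated f, flip_cols 5 f, negated (flip_cols 5 f)}. staircase 5 4 h \<or> staircase 5 5 h"
proof -
  let ?q = "\<lambda>h. [column h 4, column h 3, column h 2, column h 1, column h 0]"
  have "admissible (cols f 5)" by (rule admissible_cols[OF assms(1)]) (auto intro!: last_negative_cols)
  then have g: "admissible (?q f)" by (simp add: numeral_eq_Suc)
  then have m: "?q f \<in> set all_stair_cols"
    using assms(2) unfolding block_disc_unfold by auto
  have c: "column (flip_cols 5 h) j = column h (4 - j)" for j h
    by (simp add: column_def flip_cols_def)
  have n: "column (negated h) j = neg_col (column h j)" for j h
    by (simp add: column_def negated_def)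
  have nn: "neg_col (neg_col x) = x" for x by (cases x) simp
  have "?q (negated h) = map neg_col (?q h)" "?q (flip_cols 5 h) = rev (?q h)" for h
    by (simp_all add: n c)
  note q = this
  have rr: "rev y = x" if "y = rev x" for x y :: "col list" using that by simp
  have mm: "map neg_col y = x" if "y = map neg_col x" for x y using that by (simp add: nn o_def)
  have "set all_stair_cols = set stair_cols \<union> rev ` set stair_cols \<union> map neg_col ` set stair_cols
      \<union> map neg_col ` rev ` set stair_cols"
    by (simp only: all_stair_cols_def set_append set_map Un_assoc)
  then consider "?q f \<in> set stair_cols" | x where "x \<in> set stair_cols" "?q f = rev x"
    | x where "x \<in> set stair_cols" "?q f = map neg_col x"
    | x where "x \<in> set stair_cols" "?q f = map neg_col (rev x)"
    using m that by (simp only: Un_iff image_iff bex_simps) metis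
  then have "?q f \<in> set stair_cols \<or> ?q (negated f) \<in> set stair_cols \<or> ?q (flip_cols 5 f) \<in> set stair_cols
      \<or> ?q (negated (flip_cols 5 f)) \<in> set stair_cols"
  proof cases
    case 1 then show ?thesis by (rule disjI1)
  next
    case 2
    then have "?q (flip_cols 5 f) = x" unfolding q by (simp only: rr)
    with 2(1) show ?thesis by (simp only: simp_thms)
  next
    case 3
    then have "?q (negated f) = x" unfolding q by (simp only: mm)
    with 3(1) show ?thesis by (simp only: simp_thms)
  next
    case 4
    then have "?q (negated (flip_cols 5 f)) = x" unfolding q by (simp only: rr rev_map mm)
    with 4(1) show ?thesis by (simp only: simp_thms)
  qed
  then have "\<exists>h\<in>{f, negated f, flip_cols 5 f, negated (flip_cols 5 f)}. ?q h \<in> set stair_cols" by (simp only: bex_simps simp_thms)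
  then obtain h where h: "h \<in> {f, negated f, flip_cols 5 f, negated (flip_cols 5 f)}" "?q h \<in> set stair_cols" by blast
  have "set stair_cols = {stair_cols ! 0, stair_cols ! 1}" by (simp add: stair_cols_def)
  then have "staircase 5 4 h \<or> staircase 5 5 h" using h(2) unfolding staircase_5_iff by blast
  then show ?thesis using h(1) by blast
qed

section \<open>Growing a staircase to a corner\<close>
text \<open>
  Here \<open>h\<close> is a staircase below its first row and left of its last column, with the border between
  the two signs on or next to the antidiagonal. A square with its left side in the known part and its
  right side in column \<open>k\<close>, whose two known corners differ, forces its two corners in column
  \<open>k\<close> to agree. There are enough such squares to make the column constant, and the square of side 1
  at its bottom has two known corners \<open>-1\<close>, so the column is constantly \<open>-1\<close>. The first
  row is constantly 1 for the same reason, and the square of side \<open>k\<close> determines the new corner.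
\<close>
lemma grow_up_right:
  assumes sq: "square_free (k + 1) (k + 1) h" and k: "5 \<le> k" and t: "t + 1 = k \<or> t = k"
    and known: "\<And>i j. 1 \<le> i \<Longrightarrow> i \<le> k \<Longrightarrow> j < k \<Longrightarrow> h i j = (i + j < t + 1)"
  shows "staircase (k + 1) (t + 1) h"
proof -
  have col: "\<not> zero_sum (h i j) (h i k) (h i' j) (h i' k)" if "i < i'" "i' \<le> k" "k = j + (i' - i)" for i i' j
    by (rule square_freeD[OF sq]) (use that in auto)
  have row: "\<not> zero_sum (h 0 j) (h s j) (h 0 j') (h s j')" if "j < j'" "j' \<le> k" "s = j' - j" for j j' s
    by (subst zero_sum_swap(3), rule square_freeD[OF sq]) (use that in auto)
  (* The known corners of this square lie on the antidiagonals i + j = 2 * i + k - i' and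
     i' + j = i + k: the first is still in the triangle, the second beyond it. *)
  have c1: "h i k = h i' k" if "1 \<le> i" "i < i'" "i' \<le> k" "2 * i + k \<le> t + i'" for i i'
  proof -
    let ?j = "k - (i' - i)"
    have b: "1 \<le> i'" "i \<le> k" "?j < k" "i + ?j < t + 1" "\<not> i' + ?j < t + 1" using that t by linarith+
    then have "h i ?j" "\<not> h i' ?j" using known[of i ?j] known[of i' ?j] that by blast+
    moreover have "\<not> zero_sum (h i ?j) (h i k) (h i' ?j) (h i' k)" using that by (intro col) auto
    ultimately show ?thesis by (auto simp: zero_sum_iff)
  qed
  have "h 1 k = h k k" "h 1 k = h (k - 1) k" using c1[of 1 k] c1[of 1 "k - 1"] k t by auto
  moreover have "\<not> (h (k - 1) k \<and> h k k)"
    using col[of "k - 1" k "k - 1"] known[of "k - 1" "k - 1"] known[of k "k - 1"] k t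
    by (auto simp: zero_sum_iff)
  ultimately have c2: "\<not> h 1 k" "\<not> h k k" by blast+
  have c3: "\<not> h i k" if lim: "1 \<le> i" "i \<le> k" for i
  proof -
    consider "i = 1" | "i = 2" | "3 \<le> i"
      using lim by atomize_elim presburger
    then show ?thesis
    proof cases
      case 2
      then show ?thesis using c1[of 2 k] c2 k t by auto
    next
      case 3
      then show ?thesis using c1[of 1 i] c2 k t lim by auto
    qed (use c2 in simp)
  qed
  have r1: "h 0 j = h 0 j'" if "j < j'" "j' < k" "t + 1 \<le> 2 * j' - j" for j j'
  proof -
    have "h (j' - j) j" using known[of "j' - j" j] that t by auto
    moreover have "\<not> h (j' - j) j'" using known[of "j' - j" j'] that t by auto
    ultimately show ?thesis using row[of j j' "j' - j"] that by (auto simp: zero_sum_iff)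
  qed
  have "h 0 0 = h 0 (k - 1)" "h 0 1 = h 0 (k - 1)" using r1[of 0 "k - 1"] r1[of 1 "k - 1"] k t by auto
  moreover have "h 0 0 \<or> h 0 1"
    using row[of 0 1 1] known[of 1 0] known[of 1 1] k t by (auto simp: zero_sum_iff)
  ultimately have r2: "h 0 0" "h 0 (k - 1)" by blast+
  have r3: "h 0 j" if lim: "j < k" for j
  proof -
    consider "j = k - 1" | "j = k - 2" | "j + 3 \<le> k"
      using lim by atomize_elim presburger
    then show ?thesis
    proof cases
      case 2
      then show ?thesis using r1[of 0 "k - 2"] r2 k t by auto
    next
      case 3
      then show ?thesis using r1[of j "k - 1"] r2 k t by auto
    qed (use r2 in simp)
  qed
  have corner: "h 0 k = (t = k)"
    using row[of 0 k k] known[of k 0] c3[of k] r2 k t by (auto simp: zero_sum_iff)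
  show ?thesis
    unfolding staircase_def
  proof (intro allI impI)
    fix i j assume ij: "i < k + 1" "j < k + 1"
    show "h i j = (i + j < t + 1)"
    proof (cases "i = 0"; cases "j = k")
      assume "i = 0" "j = k" then show ?thesis using corner t by auto
    next
      assume "i = 0" "j \<noteq> k" then show ?thesis using r3[of j] t ij by auto
    next
      assume "i \<noteq> 0" "j = k" then show ?thesis using c3[of i] t ij by auto
    next
      assume "i \<noteq> 0" "j \<noteq> k" then show ?thesis using known[of i j] ij by auto
    qed
  qed
qed

lemma staircase_transposed: "staircase k t (transposed f) = staircase k t f"
  by (auto simp: staircase_def transposed_def add.commute)

lemma grow_block_up_right:
  assumes "square_free n n f" "5 \<le> k" "t + 1 = k \<or> t = k" "staircase k t (shift (Suc r) c f)" "Suc r + k \<le> n" "c + k < n"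
  shows "staircase (k + 1) (t + 1) (shift r c f)"
proof (rule grow_up_right)
  show "square_free (k + 1) (k + 1) (shift r c f)" using assms by (intro square_free_shift) auto
  show "shift r c f i j = (i + j < t + 1)" if "1 \<le> i" "i \<le> k" "j < k" for i j
    using staircaseD[OF assms(4), of "i - 1" j] that by (auto simp: shift_def)
qed (use assms in auto)

text \<open>
  Growing up and to the right, or down and to the left, stops when the block touches two adjacent sides
  of the matrix. If these meet in the bottom right corner, then rotating the matrix by a half turn and
  negating it gives a staircase in the top left corner again; its triangle is the complement, of side
  \<open>2 * k - 1 - t\<close>.
\<close>
lemma grow_to_corner:
  assumes "square_free n n f" "5 \<le> k" "t + 1 = k \<or> t = k" "r + k \<le> n" "c + k \<le> n" "staircase k t (shift r c f)"
  shows "\<exists>k' t'. 5 \<le> k' \<and> k' \<le> n \<and> (t' + 1 = k' \<or> t' = k') \<and>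
    (staircase k' t' f \<or> staircase k' t' (negated (flip_rows n (flip_cols n f))))"
  using assms(2-)
proof (induction "n - k" arbitrary: k t r c)
  case 0
  then have "k = n" "r = 0" "c = 0" by auto
  then show ?case using 0 by (auto simp: shift_0)
next
  case (Suc d)
  consider r' where "r = Suc r'" "c + k < n" | c' where "c = Suc c'" "r + k < n" | "r = 0" "c = 0" | "r + k = n" "c + k = n"
    using Suc.prems Suc.hyps(2) by (cases r; cases c; fastforce)
  then show ?case
  proof cases
    case 1
    then show ?thesis
      using grow_block_up_right[OF assms(1), of k t r' c] Suc
      by (intro Suc.hyps(1)[of "k + 1" "t + 1" r' c]) auto
  next
    case 2
    have "staircase (k + 1) (t + 1) (shift c' r (transposed f))"
      using grow_block_up_right[OF square_free_transposed[OF assms(1)], of k t c' r] 2 Suc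
      by (simp add: transposed_shift[symmetric] staircase_transposed)
    then have "staircase (k + 1) (t + 1) (shift r c' f)" by (simp add: transposed_shift[symmetric] staircase_transposed)
    then show ?thesis using 2 Suc
      by (intro Suc.hyps(1)[of "k + 1" "t + 1" r c']) auto
  next
    case 3
    then show ?thesis using Suc.prems by (auto simp: shift_0)
  next
    case 4
    have "staircase k (2 * k - 1 - t) (negated (flip_rows n (flip_cols n f)))"
      unfolding staircase_def
    proof (intro allI impI)
      fix i j assume ij: "i < k" "j < k"
      have "f (n - 1 - i) (n - 1 - j) = shift r c f (k - 1 - i) (k - 1 - j)"
        using 4 ij Suc.prems unfolding shift_def by (intro arg_cong2[of _ _ _ _ f]) auto
      also have "\<dots> = (k - 1 - i + (k - 1 - j) < t)" using ij Suc.prems by (intro staircaseD) auto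
      finally show "negated (flip_rows n (flip_cols n f)) i j = (i + j < 2 * k - 1 - t)"
        using ij Suc.prems(2) by (auto simp: negated_def flip_rows_def flip_cols_def)
    qed
    then show ?thesis using Suc.prems by (intro exI[of _ k] exI[of _ "2 * k - 1 - t"]) auto
  qed
qed

section \<open>Extending a corner staircase\<close>
text \<open>
  In the new column, entry \<open>i\<close> equals entry \<open>i'\<close> whenever the square through both meets the
  known part in a 1 at height \<open>i\<close>, which means \<open>i' > 2 * i + m - t\<close>. So the first
  entry equals all entries at positions greater than \<open>m - t\<close>, and these cannot be 1 because two of them
  are consecutive next to entries \<open>-1\<close>. The entries up to position \<open>(t - 2) / 2\<close>
  equal the last one. The two ranges cover the column exactly if \<open>2 * (m + 1) \<le> 3 * t\<close>; for larger
  \<open>m\<close> these squares leave room for a 1 in the middle.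
\<close>
lemma extend_step:
  assumes sq: "square_free (m + 1) (m + 1) f" and p: "staircase m t f" and t: "4 \<le> t" "t \<le> m" "2 * (m + 1) \<le> 3 * t"
  shows "staircase (m + 1) t f"
proof -
  have *: "\<not> g i m" if sq: "square_free (m + 1) (m + 1) g" and p: "staircase m t g" and i: "i < m" for g i
  proof -
    have c: "\<not> zero_sum (g i j) (g i m) (g i' j) (g i' m)" if "i < i'" "i' < m" "m = j + (i' - i)" for i i' j
      by (rule square_freeD[OF sq]) (use that in auto)
    have c1: "g i m = g i' m" if "i < i'" "i' < m" "2 * i + m < t + i'" for i i'
    proof -
      let ?j = "m - (i' - i)"
      have "g i ?j" "\<not> g i' ?j" using staircaseD[OF p, of i ?j] staircaseD[OF p, of i' ?j] that t by auto
      then show ?thesis using c[of i i' ?j] that by (auto simp: zero_sum_iff)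
    qed
    have "g 0 m = g (m - 1) m" "g 0 m = g (m - 2) m" using c1[of 0 "m - 1"] c1[of 0 "m - 2"] t by auto
    moreover have "\<not> (g (m - 2) m \<and> g (m - 1) m)"
      using c[of "m - 2" "m - 1" "m - 1"] staircaseD[OF p, of "m - 2" "m - 1"] staircaseD[OF p, of "m - 1" "m - 1"] t
      less_imp_diff_less[of m "m - 1"] diff_less_mono2[of 1 2 m]
      by (auto simp: zero_sum_iff)
    ultimately have z: "\<not> g 0 m" "\<not> g (m - 1) m" by blast+
    show ?thesis
    proof (cases "m < t + i")
      case True
      then show ?thesis using c1[of 0 i] z i by (cases "i = 0") auto
    next
      case False
      then show ?thesis using c1[of i "m - 1"] z i t by auto
    qed
  qed
  have col: "\<not> f i m" if "i < m" for i using *[OF sq p that] .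
  have row: "\<not> f m j" if "j < m" for j
    using *[OF square_free_transposed[OF sq], of j] p that by (simp add: staircase_transposed) (simp add: transposed_def)
  have "\<not> zero_sum (f 0 0) (f 0 m) (f m 0) (f m m)" by (rule square_freeD[OF sq]) (use t in auto)
  then have corner: "\<not> f m m" using col[of 0] row[of 0] staircaseD[OF p, of 0 0] t by (auto simp: zero_sum_iff)
  show ?thesis
    unfolding staircase_def
  proof (intro allI impI)
    fix i j assume "i < m + 1" "j < m + 1"
    then consider "i < m" "j < m" | "i = m" "j < m" | "i < m" "j = m" | "i = m" "j = m" by linarith
    then show "f i j = (i + j < t)"
      by cases (use staircaseD[OF p, of i j] col[of i] row[of j] corner t in auto)
  qed
qed

lemma extend:
  assumes "square_free n n f" "staircase k t f" "4 \<le> t" "t \<le> k" "k \<le> m" "m \<le> n" "2 * m \<le> 3 * t"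
  shows "staircase m t f"
  using assms(5-)
proof (induction m rule: dec_induct)
  case base show ?case by fact
next
  case (step m)
  have "square_free (m + 1) (m + 1) f" using square_free_shift[OF assms(1), of 0 "m + 1" 0 "m + 1"] step by (simp add: shift_0)
  then show ?case using extend_step[of m f t] step assms by simp
qed

section \<open>Staircases in different corners\<close>
text \<open>
  Only squares with their lower side in the last row are used: the upper left corner of such a square
  lies in the left staircase and the upper right corner in the right one, so each gives a
  condition on one of the first and one of the last five entries of the last row. The chosen
  squares make these conditions contradictory.
\<close>
lemma facing_corners:
  assumes sq: "square_free n n g" and n: "6 \<le> n" and p: "staircase 5 4 g"
    and q: "staircase 5 4 (flip_cols n g) \<or> staircase 5 4 (negated (flip_cols n g))"
  shows False
proof -
  define b d where "b j = g (n - 1) j" and "d j = g (n - 1) (n - 1 - j)" for j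
  have "g i (n - 1 - j) = (staircase 5 4 (flip_cols n g) = (i + j < 4))" if "i < 5" "j < 5" for i j
    using q staircaseD[of 5 4 "flip_cols n g" i j] staircaseD[of 5 4 "negated (flip_cols n g)" i j] that
    by (auto simp: flip_cols_def negated_def)
  then obtain s where s: "\<And>i j. i < 5 \<Longrightarrow> j < 5 \<Longrightarrow> g i (n - 1 - j) = (s = (i + j < 4))"
    by blast
  have sq: "\<not> zero_sum (2 * j + j' < 4) (s = (j + 2 * j' < 4)) (b j) (d j')" if "j + j' \<le> 4" for j j'
  proof -
    have "\<not> zero_sum (g (j + j') j) (g (j + j') (n - 1 - j')) (g (n - 1) j) (g (n - 1) (n - 1 - j'))"
      by (rule square_freeD[OF sq]) (use that n in auto)
    then show ?thesis using staircaseD[OF p, of "j + j'" j] s[of "j + j'" j'] that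
      by (simp add: b_def d_def mult_2 mult_2_right add_ac)
  qed
  show False
  proof (cases s)
    case True
    then show False
      using sq[of 0 0] sq[of 0 1] sq[of 1 0] sq[of 2 0] sq[of 0 2] sq[of 1 2] sq[of 2 1] sq[of 2 2]
      by (simp add: zero_sum_iff) blast?
  next
    case False
    then show False
      using sq[of 0 0] sq[of 0 2] sq[of 2 0] sq[of 1 0] sq[of 1 2] sq[of 2 2]
      by (simp add: zero_sum_iff) blast?
  qed
qed

text \<open>
  The squares used have their upper left corner in one staircase and their lower right corner in the
  other. Each gives a condition on one entry \<open>u i j'\<close> near the top right corner and one entry
  \<open>w i' j\<close> near the bottom left corner, and the chosen squares are contradictory. The lower bound on
  \<open>n\<close> ensures that they have positive side.
\<close>
lemma opposite_corners:
  assumes sq: "square_free n n g" and n: "7 \<le> n" and p: "staircase 5 t g" and q: "staircase 5 t' (flip_rows n (flip_cols n g))"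
    and t: "t = 4 \<or> t = 5" "t' = 4 \<or> t' = 5" and n8: "t = 4 \<or> t' = 4 \<or> 8 \<le> n"
  shows False
proof -
  define u w where "u i j = g i (n - 1 - j)" and "w i j = g (n - 1 - i) j" for i j
  have *: "\<not> zero_sum (i + j < t) (u i j') (w i' j) (i' + j' < t')"
    if "i < 5" "j < 5" "i' < 5" "j' < 5" "i + i' = j + j'" "i + i' + 2 \<le> n" for i j i' j'
  proof -
    have "\<not> zero_sum (g i j) (g i (n - 1 - j')) (g (n - 1 - i') j) (g (n - 1 - i') (n - 1 - j'))"
      by (rule square_freeD[OF sq]) (use that in auto)
    then show ?thesis using staircaseD[OF p, of i j] staircaseD[OF q, of i' j'] that
      by (simp add: u_def w_def flip_rows_def flip_cols_def)
  qed
  consider "t = 4" "t' = 4" | "t = 4" "t' = 5" | "t = 5" "t' = 4" | "t = 5" "t' = 5" "8 \<le> n"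
    using t n8 by blast
  then show False
  proof cases
    case 1
    then show False
      using *[of 3 3 2 2] *[of 2 3 2 1] *[of 3 1 0 2] *[of 2 2 1 1] *[of 3 2 1 2] *[of 2 1 0 1] n
      by (simp add: zero_sum_iff) blast?
  next
    case 2
    then show False
      using *[of 0 3 4 1] *[of 3 0 1 4] *[of 0 1 2 1] *[of 1 1 2 2] *[of 3 1 2 4] *[of 1 3 4 2] *[of 1 0 1 2] *[of 0 0 1 1] n
      by (simp add: zero_sum_iff) blast?
  next
    case 3
    then show False
      using *[of 3 1 1 3] *[of 3 2 2 3] *[of 1 1 1 1] *[of 0 4 4 0] *[of 1 2 2 1] *[of 1 4 4 1] *[of 0 2 2 0] *[of 0 1 1 0] n
      by (simp add: zero_sum_iff) blast?
  next
    case 4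
    then show False
      using *[of 2 3 2 1] *[of 3 2 1 2] *[of 3 3 2 2] *[of 2 2 1 1] *[of 2 4 3 1] *[of 3 4 3 2]
      by (simp add: zero_sum_iff) blast?
  qed
qed

section \<open>Corner staircases in matrices that are not split\<close>
definition is_split :: "nat \<Rightarrow> sign_matrix \<Rightarrow> bool" where
  "is_split n f \<longleftrightarrow> (\<exists>t. staircase n t f \<or> staircase n t (flip_rows n f) \<or> staircase n t (flip_cols n f) \<or> staircase n t (flip_rows n (flip_cols n f)))"

lemma flip_rows_flip_cols: "flip_rows n (flip_cols m f) = flip_cols m (flip_rows n f)"
  by (simp add: flip_rows_def flip_cols_def)

lemma negated_flip: "flip_rows n (negated f) = negated (flip_rows n f)" "flip_cols n (negated f) = negated (flip_cols n f)" "negated (negated f) = f"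
  by (simp_all add: flip_rows_def flip_cols_def negated_def)

lemma transposed_flip: "transposed (flip_rows n f) = flip_cols n (transposed f)" "transposed (flip_cols n f) = flip_rows n (transposed f)" "transposed (negated f) = negated (transposed f)"
  by (simp_all add: transposed_def flip_rows_def flip_cols_def negated_def)

lemma staircase_cong: "(\<And>i j. i < k \<Longrightarrow> j < k \<Longrightarrow> f i j = g i j) \<Longrightarrow> staircase k t f = staircase k t g"
  by (auto simp: staircase_def)

lemma staircase_flip_flip:
  assumes "k \<le> n"
  shows "staircase k t (flip_cols n (flip_cols n f)) = staircase k t f" "staircase k t (flip_rows n (flip_rows n f)) = staircase k t f"
    "staircase k t (flip_rows n (flip_cols n (flip_cols n f))) = staircase k t (flip_rows n f)"
    "staircase k t (flip_cols n (flip_rows n (flip_rows n f))) = staircase k t (flip_cols n f)"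
    "staircase k t (negated (flip_rows n (flip_cols n (flip_cols n f)))) = staircase k t (negated (flip_rows n f))"
  using assms by (auto intro!: staircase_cong simp: flip_rows_def flip_cols_def negated_def)

text \<open>
  A half turn exchanges the triangle with its complement.
\<close>
lemma staircase_negated: "staircase n t (negated f) \<Longrightarrow> staircase n (2 * n - 1 - t) (flip_rows n (flip_cols n f))"
proof -
  assume p: "staircase n t (negated f)"
  have "flip_rows n (flip_cols n f) i j = (i + j < 2 * n - 1 - t)" if "i < n" "j < n" for i j
    using staircaseD[OF p, of "n - 1 - i" "n - 1 - j"] that by (auto simp: flip_rows_def flip_cols_def negated_def)
  then show ?thesis by (simp add: staircase_def)
qed

lemma is_split_flip_cols: "is_split n (flip_cols n f) \<Longrightarrow> is_split n f"
  unfolding is_split_def by (auto simp: staircase_flip_flip)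

lemma is_split_flip_rows: "is_split n (flip_rows n f) \<Longrightarrow> is_split n f"
  unfolding is_split_def by (auto simp: staircase_flip_flip flip_rows_flip_cols)

lemma is_split_transposed: "is_split n (transposed f) \<Longrightarrow> is_split n f"
  unfolding is_split_def transposed_flip[symmetric] staircase_transposed by (auto simp: flip_rows_flip_cols)

lemma is_split_negated: "is_split n (negated f) \<Longrightarrow> is_split n f"
  unfolding is_split_def negated_flip
  by (auto dest!: staircase_negated simp: staircase_flip_flip flip_rows_flip_cols[symmetric])

text \<open>
  The relation between \<open>k\<close> and \<open>t\<close> says that the border between the signs runs along the
  antidiagonal of the corner square or next to it, as it does for a low \<open>5 \<times> 5\<close> block and all
  blocks grown from it.
\<close>
definition corner :: "nat \<Rightarrow> nat \<Rightarrow> nat \<Rightarrow> sign_matrix \<Rightarrow> bool" where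
  "corner n k t f \<longleftrightarrow> square_free n n f \<and> \<not> is_split n f \<and> staircase k t f \<and> 5 \<le> k \<and> k \<le> n \<and> (t + 1 = k \<or> t = k)"

lemma corner_transposed: "corner n k t f \<Longrightarrow> corner n k t (transposed f)"
  unfolding corner_def using square_free_transposed[of n n f] is_split_transposed[of n f] by (auto simp: staircase_transposed)

lemma corner_extend:
  assumes "corner n k t f"
  shows "4 \<le> t" "3 * t div 2 < n" "staircase (3 * t div 2) t f"
proof -
  have c: "square_free n n f" "\<not> is_split n f" "staircase k t f" "5 \<le> k" "k \<le> n" "t + 1 = k \<or> t = k"
    using assms by (auto simp: corner_def)
  show t: "4 \<le> t" using c by auto
  have e: "staircase m t f" if "k \<le> m" "m \<le> n" "2 * m \<le> 3 * t" for m
    using extend[OF c(1,3) t _ that] c by auto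
  show n: "3 * t div 2 < n"
  proof (rule ccontr)
    assume "\<not> 3 * t div 2 < n"
    then have "staircase n t f" using c by (intro e) auto
    then show False using c(2) by (auto simp: is_split_def)
  qed
  show "staircase (3 * t div 2) t f" using c n t by (intro e) auto
qed

text \<open>
  Removing \<open>a\<close> rows at the top and \<open>b\<close> columns on the left shrinks the triangle on the left by
  \<open>a + b\<close>, and similarly on the right. So both triangles can be shrunk to side 4, and the
  remaining columns span a square of size \<open>n'\<close> that still fits into the remaining rows. The
  number \<open>a\<close> is the least one for which \<open>n' \<ge> 6\<close>; the extended staircases guarantee that it is not too
  large.
\<close>
lemma no_facing_corners:
  assumes f: "corner n k t f" and g: "corner n k' t' g" "g = flip_cols n f \<or> g = negated (flip_cols n f)"
  shows False
proof -
  note F = corner_extend[OF f] and G = corner_extend[OF g(1)]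
  define a b b' n' where "a = (t + t' - n - 1) div 2" and "b = t - a - 4" and "b' = t' - a - 4" and "n' = n - b - b'"
  have A: "a + 4 \<le> t" "a + 4 \<le> t'" using F(1,2) G(1,2) unfolding a_def by linarith+
  have bb: "b + a + 4 = t" "b' + a + 4 = t'" using A by (auto simp: b_def b'_def)
  have B: "b + b' + 6 \<le> n" "a \<le> b + b'" using A F(1,2) G(1,2) bb unfolding a_def by linarith+
  have n': "n' + b + b' = n" using B by (simp add: n'_def)
  have C: "a + 5 \<le> 3 * t div 2" "b + 5 \<le> 3 * t div 2" "a + 5 \<le> 3 * t' div 2" "b' + 5 \<le> 3 * t' div 2"
    using A F(1) G(1) bb by linarith+
  show False
  proof (rule facing_corners)
    show "square_free n' n' (shift a b f)" using f n' B unfolding corner_def by (intro square_free_shift) auto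
    show "6 \<le> n'" using n' B by simp
    show "staircase 5 4 (shift a b f)"
      unfolding staircase_def
    proof (intro allI impI)
      fix i j :: nat assume "i < 5" "j < 5"
      then show "shift a b f i j = (i + j < 4)"
        using staircaseD[OF F(3), of "a + i" "b + j"] C bb by (auto simp: shift_def)
    qed
    have g': "g (a + i) (b' + j) = (i + j < 4)" if "i < 5" "j < 5" for i j
      using staircaseD[OF G(3), of "a + i" "b' + j"] C bb that by auto
    have "flip_cols n' (shift a b f) i j = flip_cols n f (a + i) (b' + j)" if "j < 5" for i j
      using that n' B by (auto simp: flip_cols_def shift_def intro!: arg_cong2[of _ _ _ _ f])
    then show "staircase 5 4 (flip_cols n' (shift a b f)) \<or> staircase 5 4 (negated (flip_cols n' (shift a b f)))"
      using g' g(2) by (auto simp: staircase_def negated_def)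
  qed
qed

text \<open>
  Removing \<open>a\<close> rows at the top and as many columns on the left shrinks the triangle by \<open>2 * a\<close>,
  which leads to side 4 or 5 in both corners.
\<close>
lemma no_opposite_corners:
  assumes f: "corner n k t f" and g: "corner n k' t' (flip_rows n (flip_cols n f))"
  shows False
proof -
  note F = corner_extend[OF f] and G = corner_extend[OF g]
  define a a' n' where "a = (t - 4) div 2" and "a' = (t' - 4) div 2" and "n' = n - a - a'"
  define s s' where "s = t - 2 * a" and "s' = t' - 2 * a'"
  have s: "s = 4 \<or> s = 5" "s' = 4 \<or> s' = 5" "s + 2 * a = t" "s' + 2 * a' = t'"
    using F(1) G(1) unfolding s_def s'_def a_def a'_def by presburger+
  have n': "n' + a + a' = n" using F(1,2) G(1,2) unfolding n'_def a_def a'_def by linarith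
  have C: "a + 5 \<le> 3 * t div 2" "a' + 5 \<le> 3 * t' div 2" using s F(1) G(1) by linarith+
  show False
  proof (rule opposite_corners)
    show "square_free n' n' (shift a a f)" using f n' unfolding corner_def by (intro square_free_shift) auto
    show "7 \<le> n'" using s F(1,2) G(1,2) n' by linarith
    show "s = 4 \<or> s = 5" "s' = 4 \<or> s' = 5" by fact+
    show "s = 4 \<or> s' = 4 \<or> 8 \<le> n'"
    proof (rule ccontr)
      assume "\<not> (s = 4 \<or> s' = 4 \<or> 8 \<le> n')"
      then have "s = 5" "s' = 5" "n' < 8" using s by auto
      then show False using s F(1,2) G(1,2) n' by linarith
    qed
    show "staircase 5 s (shift a a f)"
      unfolding staircase_def
    proof (intro allI impI)
      fix i j :: nat assume "i < 5" "j < 5"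
      then show "shift a a f i j = (i + j < s)"
        using staircaseD[OF F(3), of "a + i" "a + j"] C s by (auto simp: shift_def)
    qed
    have g': "flip_rows n (flip_cols n f) (a' + i) (a' + j) = (i + j < s')" if "i < 5" "j < 5" for i j
      using staircaseD[OF G(3), of "a' + i" "a' + j"] C s that by auto
    have "flip_rows n' (flip_cols n' (shift a a f)) i j = flip_rows n (flip_cols n f) (a' + i) (a' + j)" if "i < 5" "j < 5" for i j
      using that n' \<open>7 \<le> n'\<close> by (auto simp: flip_rows_def flip_cols_def shift_def intro!: arg_cong2[of _ _ _ _ f])
    then show "staircase 5 s' (flip_rows n' (flip_cols n' (shift a a f)))"
      using g' by (auto simp: staircase_def)
  qed
qed

text \<open>
  A low block is taken with one of the four orientations; the other three are treated by applying this
  to the negated or reflected matrix.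
\<close>
lemma low_block_corner:
  assumes "square_free n n f" "\<not> is_split n f" "r + 5 \<le> n" "c + 5 \<le> n" "staircase 5 4 (shift r c f) \<or> staircase 5 5 (shift r c f)"
  shows "\<exists>k t. corner n k t f \<or> corner n k t (negated (flip_rows n (flip_cols n f)))"
proof -
  obtain t where t: "t + 1 = 5 \<or> t = 5" "staircase 5 t (shift r c f)" using assms(5) by auto
  have "square_free n n (negated (flip_rows n (flip_cols n f)))" using assms(1) by (intro square_free_negated square_free_flip_rows square_free_flip_cols)
  moreover have "\<not> is_split n (negated (flip_rows n (flip_cols n f)))" using assms(2) is_split_negated is_split_flip_rows is_split_flip_cols by blast
  ultimately show ?thesis
    using grow_to_corner[OF assms(1) _ t(1) assms(3,4) t(2)] assms(1,2) unfolding corner_def by blast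
qed

lemma flip_cols_block:
  assumes "c + 5 \<le> n"
  shows "staircase 5 t (flip_cols 5 (shift r c f)) = staircase 5 t (shift r (n - 5 - c) (flip_cols n f))"
    "staircase 5 t (negated (flip_cols 5 (shift r c f))) = staircase 5 t (shift r (n - 5 - c) (negated (flip_cols n f)))"
proof -
  have "flip_cols 5 (shift r c f) i j = shift r (n - 5 - c) (flip_cols n f) i j" if "j < 5" for i j
  proof -
    have "c + (5 - 1 - j) = n - 1 - (n - 5 - c + j)" using assms that by linarith
    then show ?thesis unfolding flip_cols_def shift_def by (simp only:)
  qed
  then show "staircase 5 t (flip_cols 5 (shift r c f)) = staircase 5 t (shift r (n - 5 - c) (flip_cols n f))"
    "staircase 5 t (negated (flip_cols 5 (shift r c f))) = staircase 5 t (shift r (n - 5 - c) (negated (flip_cols n f)))"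
    by (auto intro!: staircase_cong simp: negated_def shift_def)
qed

lemma low_block_staircase:
  assumes sq: "square_free n n f" and rc: "r + 5 \<le> n" "c + 5 \<le> n"
    and low: "\<bar>block_disc 5 5 (shift r c f)\<bar> < 7"
    and p: "\<And>h. p h \<longleftrightarrow> staircase 5 4 h \<or> staircase 5 5 h"
  shows "p (shift r c f) \<or> p (shift r c (negated f)) \<or> p (shift r (n - 5 - c) (flip_cols n f)) \<or>
    p (shift r (n - 5 - c) (negated (flip_cols n f)))"
proof -
  have "square_free 5 5 (shift r c f)" using sq rc by (intro square_free_shift)
  from low_5x5_staircase[OF this low] show ?thesis
    unfolding p flip_cols_block[OF rc(2), symmetric] by (auto simp: shift_def negated_def)
qed

text \<open>
  Each of the other three orientations of a low block leads, by growing, to a staircase in another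
  corner, or to a staircase starting with \<open>-1\<close> in the corner where \<open>f\<close> starts with 1.
\<close>
lemma low_block_near_corner:
  assumes f: "corner n k t f" and rc: "r + 5 \<le> n" "c + 5 \<le> n"
    and low: "\<bar>block_disc 5 5 (shift r c f)\<bar> < 7"
  shows "staircase 5 4 (shift r c f) \<or> staircase 5 5 (shift r c f)"
proof -
  have sq: "square_free n n f" and ns: "\<not> is_split n f" using f by (auto simp: corner_def)
  let ?p = "\<lambda>h. staircase 5 4 h \<or> staircase 5 5 h"
  have fr: "\<not> corner n k t (flip_cols n f)" "\<not> corner n k t (negated (flip_cols n f))" for k t
    using no_facing_corners[OF f] by blast+
  have fc: "\<not> corner n k t (flip_rows n f)" "\<not> corner n k t (negated (flip_rows n f))" for k t
    using no_facing_corners[OF corner_transposed[OF f]] corner_transposed[of n k t "flip_rows n f"] corner_transposed[of n k t "negated (flip_rows n f)"]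
    by (auto simp: transposed_flip)
  have nsr: "\<not> is_split n (flip_rows n f)" "\<not> is_split n (negated (flip_rows n f))" using ns is_split_flip_rows is_split_negated by blast+
  have cc: "corner n k t (flip_rows n f)" if "corner n k t (flip_rows n (flip_cols n (flip_cols n f)))" for k t
    using that square_free_flip_rows[OF sq] nsr(1) staircase_flip_flip(3)[of k n t f] by (auto simp: corner_def)
  have cn: "corner n k t (negated (flip_rows n f))" if "corner n k t (negated (flip_rows n (flip_cols n (flip_cols n f))))" for k t
    using that square_free_negated[OF square_free_flip_rows[OF sq]] nsr(2) staircase_flip_flip(5)[of k n t f] by (auto simp: corner_def)
  from low_block_staircase[OF sq rc low, of ?p]
  consider "?p (shift r c f)" | "?p (shift r c (negated f))" | "?p (shift r (n - 5 - c) (flip_cols n f))"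
    | "?p (shift r (n - 5 - c) (negated (flip_cols n f)))"
    by blast
  then show ?thesis
  proof cases
    case 2
    have "square_free n n (negated f)" "\<not> is_split n (negated f)" using sq ns square_free_negated is_split_negated by blast+
    from low_block_corner[OF this rc 2] obtain k' t' where
      "corner n k' t' (negated f) \<or> corner n k' t' (flip_rows n (flip_cols n f))" by (auto simp: negated_flip)
    moreover have "\<not> corner n k' t' (negated f)"
    proof
      assume g: "corner n k' t' (negated f)"
      have "f 0 0" using corner_extend(1)[OF f] f staircaseD[of k t f 0 0] by (auto simp: corner_def)
      moreover have "negated f 0 0" using corner_extend(1)[OF g] g staircaseD[of k' t' "negated f" 0 0] by (auto simp: corner_def)
      ultimately show False by (simp add: negated_def)
    qed
    ultimately show ?thesis using no_opposite_corners[OF f] by blast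
  next
    case 3
    have "square_free n n (flip_cols n f)" "\<not> is_split n (flip_cols n f)" using sq ns square_free_flip_cols is_split_flip_cols by blast+
    from low_block_corner[OF this rc(1) _ 3] rc obtain k' t' where
      "corner n k' t' (flip_cols n f) \<or> corner n k' t' (negated (flip_rows n (flip_cols n (flip_cols n f))))" by auto
    then show ?thesis using fr fc cn by blast
  next
    case 4
    have "square_free n n (negated (flip_cols n f))" "\<not> is_split n (negated (flip_cols n f))" using sq ns square_free_flip_cols is_split_flip_cols square_free_negated is_split_negated by blast+
    from low_block_corner[OF this rc(1) _ 4] rc obtain k' t' where
      "corner n k' t' (negated (flip_cols n f)) \<or> corner n k' t' (flip_rows n (flip_cols n (flip_cols n f)))" by (auto simp: negated_flip)
    then show ?thesis using fr fc cc by blast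
  qed
qed

section \<open>Blocks outside a corner staircase\<close>
text \<open>
  Since \<open>-7 + 10 < 7\<close>, the block can only fail to be negative by being low. Then it is a staircase
  starting with 1, whose first four rows contain at least as many 1 as \<open>-1\<close>; so the
  block one row higher would have discrepancy at least \<open>-5\<close>.
\<close>
lemma slide_down:
  assumes f: "corner n k t f" and rc: "Suc r + 5 \<le> n" "c + 5 \<le> n" and neg: "block_disc 5 5 (shift r c f) \<le> -7"
  shows "block_disc 5 5 (shift (Suc r) c f) \<le> -7"
proof -
  let ?C = "block_disc 4 5 (shift (Suc r) c f)"
  have old: "block_disc 5 5 (shift r c f) = block_disc 1 5 (shift r c f) + ?C"
    using block_disc_rows[of 1 4 5 "shift r c f"] by (simp add: shift_shift)
  have new: "block_disc 5 5 (shift (Suc r) c f) = ?C + block_disc 1 5 (shift (Suc r + 4) c f)"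
    using block_disc_rows[of 4 1 5 "shift (Suc r) c f"] by (simp add: shift_shift)
  have low: "- block_disc 1 5 (shift r c f) \<le> 5"
    using block_disc_le[of 1 5 "negated (shift r c f)"] by (simp add: block_disc_negated)
  have up: "block_disc 1 5 (shift (Suc r + 4) c f) \<le> 5"
    using block_disc_le[of 1 5 "shift (Suc r + 4) c f"] by simp
  have "\<not> (staircase 5 4 (shift (Suc r) c f) \<or> staircase 5 5 (shift (Suc r) c f))"
  proof
    assume "staircase 5 4 (shift (Suc r) c f) \<or> staircase 5 5 (shift (Suc r) c f)"
    then obtain t' where t': "t' = 4 \<or> t' = 5" "staircase 5 t' (shift (Suc r) c f)" by blast
    have "?C = block_disc 4 5 (\<lambda>i j. i + j < t')"
      using staircaseD[OF t'(2)] by (auto simp: block_disc_def intro!: sum.cong)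
    also have "\<dots> \<ge> 0" using t'(1) by (auto simp: block_disc_def numeral_eq_Suc sg_def)
    finally have "0 \<le> ?C" .
    then show False using old low neg by linarith
  qed
  then have "7 \<le> \<bar>block_disc 5 5 (shift (Suc r) c f)\<bar>"
    using low_block_near_corner[OF f rc] by linarith
  then show ?thesis using old new low up neg by linarith
qed

lemma slide_right:
  assumes f: "corner n k t f" and rc: "r + 5 \<le> n" "Suc c + 5 \<le> n" and neg: "block_disc 5 5 (shift r c f) \<le> -7"
  shows "block_disc 5 5 (shift r (Suc c) f) \<le> -7"
  using slide_down[OF corner_transposed[OF f] rc(2,1)] neg by (simp add: transposed_shift[symmetric] block_disc_transposed)

text \<open>
  All these blocks are reached by moving down and to the right from the block whose top left corner
  is in row \<open>t - 3\<close> and column 0. It lies in the extended staircase and contains six 1.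
\<close>
lemma negative_below:
  assumes f: "corner n k t f" and rc: "r + 5 \<le> n" "c + 5 \<le> n" "t \<le> r + 3"
  shows "block_disc 5 5 (shift r c f) \<le> -7"
proof -
  note F = corner_extend[OF f]
  have start: "block_disc 5 5 (shift (t - 3) 0 f) \<le> -7"
  proof -
    have "shift (t - 3) 0 f i j = (i + j < 3)" if "i < 5" "j < 5" for i j
      using staircaseD[OF F(3), of "t - 3 + i" j] F(1) that by (auto simp: shift_def)
    then have "block_disc 5 5 (shift (t - 3) 0 f) = block_disc 5 5 (\<lambda>i j. i + j < 3)"
      by (auto simp: block_disc_def intro!: sum.cong)
    also have "\<dots> = -13" by (simp add: block_disc_def numeral_eq_Suc sg_def)
    finally show ?thesis by simp
  qed
  have down: "block_disc 5 5 (shift r 0 f) \<le> -7" if "t - 3 \<le> r" "r + 5 \<le> n" for r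
    using that by (induction r rule: dec_induct) (use start slide_down[OF f] F(2) in auto)
  show ?thesis
    using rc(2)
  proof (induction c)
    case 0
    show ?case using down[of r] rc by auto
  next
    case (Suc c)
    then show ?case using slide_right[OF f rc(1), of c] by auto
  qed
qed

lemma negative_outside:
  assumes f: "corner n k t f" and rc: "r + 5 \<le> n" "c + 5 \<le> n" "t \<le> r + 3 \<or> t \<le> c + 3"
  shows "block_disc 5 5 (shift r c f) \<le> -7"
  using negative_below[OF f rc(1,2)] negative_below[OF corner_transposed[OF f] rc(2,1)] rc(3)
  by (auto simp: transposed_shift[symmetric] block_disc_transposed)

section \<open>Adding hooks\<close>
text \<open>
  A strip of width 8 consists of one of width 7 and a last column.
\<close>
lemma negative_5x8:
  assumes "negative 5 8 f"
  shows "block_disc 4 8 (shift 1 0 f) \<le> -10"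
proof -
  have "block_disc 4 7 (shift 1 0 f) \<le> -12"
    using negative_5x7[OF negative_shift[OF assms, of 0 5 0 7]] by (simp add: shift_0)
  moreover have "block_disc 4 1 (shift 1 7 f) \<le> 2"
    using negative_5x5(4)[OF negative_shift[OF assms, of 0 5 3 5]] by (simp add: shift_shift)
  ultimately show ?thesis
    using block_disc_cols[of 4 7 1 "shift 1 0 f"] by (simp add: shift_shift)
qed

text \<open>
  Widths 5 and 6 keep the better bounds from the search, which are needed for the two smallest corner
  staircases.
\<close>
definition strip :: "nat \<Rightarrow> int" where
  "strip w = (if w = 5 then 6 else if w = 6 then 10 else int w)"

lemma negative_strip:
  assumes "negative 5 w f" "5 \<le> w"
  shows "block_disc 4 w (shift 1 0 f) \<le> - strip w"
  using assms
proof (induction w rule: less_induct)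
  case (less w)
  consider "w = 5" | "w = 6" | "w = 7" | "w = 8" | "9 \<le> w" using less.prems(2) by linarith
  then show ?case
  proof cases
    case 5
    define v where "v = w - 4"
    then have v: "w = v + 4" "5 \<le> v" using 5 by auto
    have "block_disc 4 v (shift 1 0 f) \<le> - strip v"
      using less.IH[of v] negative_shift[OF less.prems(1), of 0 5 0 v] v by (simp add: shift_0)
    then have "block_disc 4 v (shift 1 0 f) \<le> - int v" by (auto simp: strip_def split: if_splits)
    moreover have "block_disc 4 4 (shift 1 v f) \<le> -4"
      using negative_5x5(2)[OF negative_shift[OF less.prems(1), of 0 5 "v - 1" 5]] v by (simp add: shift_shift)
    ultimately show ?thesis
      using v block_disc_cols[of 4 v 4 "shift 1 0 f"] by (simp add: shift_shift strip_def)
  next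
    case 1 then show ?thesis using negative_5x5(3) less.prems(1) by (simp add: strip_def)
  next
    case 2 then show ?thesis using negative_5x6(1) less.prems(1) by (simp add: strip_def)
  next
    case 3 then show ?thesis using negative_5x7[of f] less.prems(1) by (simp add: strip_def)
  next
    case 4 then show ?thesis using negative_5x8[of f] less.prems(1) by (simp add: strip_def)
  qed
qed

lemma block_disc_hook:
  "block_disc (a + b) (a + b) f = block_disc a a f + block_disc a b (shift 0 a f) + block_disc b a (shift a 0 f) + block_disc b b (shift a a f)"
  by (simp add: block_disc_rows block_disc_cols shift_shift)

definition negative_from :: "nat \<Rightarrow> nat \<Rightarrow> sign_matrix \<Rightarrow> bool" where
  "negative_from b n f \<longleftrightarrow> square_free n n f \<and>
     (\<forall>r c. r + 5 \<le> n \<longrightarrow> c + 5 \<le> n \<longrightarrow> b \<le> r + 1 \<or> b \<le> c + 1 \<longrightarrow> block_disc 5 5 (shift r c f) \<le> -7)"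

lemma negative_from_transposed: "negative_from b n f \<Longrightarrow> negative_from b n (transposed f)"
  using square_free_transposed[of n n f] by (auto simp: negative_from_def transposed_shift[symmetric] block_disc_transposed)

lemma negative_from_shift:
  assumes "negative_from b n f" "r + x \<le> n" "c + y \<le> n" "b \<le> r + 1"
  shows "negative x y (shift r c f)"
  using assms square_free_shift[of n n f r x c y] by (auto simp: negative_def negative_from_def shift_shift)

text \<open>
  The hook consists of a strip of four rows, one of four columns and a \<open>4 \<times> 4\<close> square.
\<close>
lemma hook:
  assumes f: "negative_from b n f" and b: "5 \<le> b" "b + 4 \<le> n"
  shows "block_disc (b + 4) (b + 4) f \<le> block_disc b b f - 2 * strip b - 4"
proof -
  have low: "block_disc 4 b (shift b 0 g) \<le> - strip b" if "negative_from b n g" for g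
    using negative_strip[OF negative_from_shift[OF that, of "b - 1" 5 0 b]] b by (simp add: shift_shift)
  have "block_disc b 4 (shift 0 b f) \<le> - strip b"
    using low[OF negative_from_transposed[OF f]] by (simp add: transposed_shift[symmetric] block_disc_transposed)
  moreover have "block_disc 4 4 (shift b b f) \<le> -4"
    using negative_5x5(2)[OF negative_from_shift[OF f, of "b - 1" 5 "b - 1" 5]] b by (simp add: shift_shift)
  ultimately show ?thesis using low[OF f] unfolding block_disc_hook by linarith
qed

text \<open>
  A hook of width four around a square of size \<open>b\<close> has area \<open>8 * b + 16\<close> and discrepancy at most
  \<open>- (2 * b + 4)\<close>, so it preserves the bound of minus a quarter of the area.
\<close>
lemma ladder:
  assumes f: "negative_from b n f" and b: "5 \<le> b" "b \<le> n"
    and base: "\<And>a. b \<le> a \<Longrightarrow> a < b + 4 \<Longrightarrow> a \<le> n \<Longrightarrow> 4 * block_disc a a f < - (int a * int a)"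
  shows "4 * block_disc n n f < - (int n * int n)"
proof -
  have "4 * block_disc a a f < - (int a * int a)" if "b \<le> a" "a \<le> n" for a
    using that
  proof (induction a rule: less_induct)
    case (less a)
    show ?case
    proof (cases "a < b + 4")
      case True then show ?thesis using base less.prems by blast
    next
      case False
      define v where "v = a - 4"
      have v: "a = v + 4" "b \<le> v" using False by (auto simp: v_def)
      have "negative_from v n f" using f v by (auto simp: negative_from_def)
      then have "block_disc a a f \<le> block_disc v v f - 2 * strip v - 4" using hook[of v n f] v b less.prems by simp
      moreover have "4 * block_disc v v f < - (int v * int v)" using less v by simp
      moreover have "strip v \<ge> int v" by (simp add: strip_def)
      ultimately show ?thesis using v by (simp add: algebra_simps)
    qed
  qed
  then show ?thesis using b by blast
qed

text \<open>
  Sizes 6, 7 and 8 are cut horizontally into a strip of four rows and the remaining rows.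
\<close>
lemma negative_small:
  assumes f: "negative n n f" and n: "5 \<le> n" "n < 9"
  shows "4 * block_disc n n f < - (int n * int n)"
proof -
  consider "n = 5" | "n = 6" | "n = 7" | "n = 8" using n by linarith
  then show ?thesis
  proof cases
    case 1 then show ?thesis using negative_5x5(1) f by fastforce
  next
    case 2
    have "block_disc 2 6 f \<le> 0"
      using negative_5x6(3)[OF negative_shift[OF f, of 0 5 0 6]] 2 by (simp add: shift_0)
    moreover have "block_disc 4 6 (shift 2 0 f) \<le> -10"
      using negative_5x6(1)[OF negative_shift[OF f, of 1 5 0 6]] 2 by (simp add: shift_shift numeral_eq_Suc)
    ultimately show ?thesis using block_disc_rows[of 2 4 6 f] 2 by simp
  next
    case 3
    have "block_disc 3 6 f \<le> -4"
      using negative_5x6(2)[OF negative_shift[OF f, of 0 5 0 6]] 3 by (simp add: shift_0)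
    moreover have "block_disc 3 1 (shift 0 6 f) \<le> 3" using block_disc_le[of 3 1 "shift 0 6 f"] by simp
    moreover have "block_disc 4 7 (shift 3 0 f) \<le> -12"
      using negative_5x7[OF negative_shift[OF f, of 2 5 0 7]] 3 by (simp add: shift_shift numeral_eq_Suc)
    ultimately show ?thesis using block_disc_rows[of 3 4 7 f] block_disc_cols[of 3 6 1 f] 3 by simp
  next
    case 4
    (* The upper four of the five rows are handled by turning them upside down. *)
    have "negative 5 8 (flip_rows 5 f)"
    proof -
      have g: "negative 5 8 f" using negative_shift[OF f, of 0 5 0 8] 4 by (simp add: shift_0)
      have "shift 0 c (flip_rows 5 f) = flip_rows 5 (shift 0 c f)" for c by (simp add: shift_def flip_rows_def)
      then show ?thesis using g square_free_flip_rows[of 5 8 f] by (auto simp: negative_def block_disc_flip_rows)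
    qed
    then have "block_disc 4 8 (shift 1 0 (flip_rows 5 f)) \<le> -10" by (rule negative_5x8)
    moreover have "shift 1 0 (flip_rows 5 f) = flip_rows 4 f" by (simp add: shift_def flip_rows_def)
    ultimately have "block_disc 4 8 f \<le> -10" by (simp add: block_disc_flip_rows)
    moreover have "block_disc 4 8 (shift 4 0 f) \<le> -10"
      using negative_5x8[OF negative_shift[OF f, of 3 5 0 8]] 4 by (simp add: shift_shift numeral_eq_Suc)
    ultimately show ?thesis using block_disc_rows[of 4 4 8 f] 4 by simp
  qed
qed

lemma negative_bound:
  assumes "negative n n f" "5 \<le> n"
  shows "4 * block_disc n n f < - (int n * int n)"
proof (rule ladder[of 5])
  show "negative_from 5 n f" using assms(1) by (auto simp: negative_def negative_from_def)
  show "4 * block_disc a a f < - (int a * int a)" if "5 \<le> a" "a < 5 + 4" "a \<le> n" for a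
    using negative_small[of a f] negative_shift[OF assms(1), of 0 a 0 a] that by (simp add: shift_0)
qed (use assms in auto)

section \<open>Discrepancy in the presence of a corner staircase\<close>
lemma sum_sg_card: "(\<Sum>i<m. sg (x i)) = 2 * int (card {i. i < m \<and> x i}) - int m"
proof (induction m)
  case (Suc m)
  have "{i. i < Suc m \<and> x i} = (if x m then insert m {i. i < m \<and> x i} else {i. i < m \<and> x i})"
    by (auto simp: less_Suc_eq)
  then show ?case using Suc by (simp add: sg_def)
qed simp

lemma block_disc_staircase:
  assumes "staircase m t f" "t \<le> m"
  shows "block_disc m m f = int t * (int t + 1) - int m * int m"
proof -
  have row: "(\<Sum>j<m. sg (f i j)) = 2 * int (t - i) - int m" if "i < m" for i
  proof -
    have "{j. j < m \<and> f i j} = {..<t - i}" using staircaseD[OF assms(1), of i] that assms(2) by auto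
    then show ?thesis by (simp add: sum_sg_card)
  qed
  have tri: "(\<Sum>i<m. 2 * int (t - i)) = int t * (int t + 1)" if "t \<le> m" for m t
    using that
  proof (induction m arbitrary: t)
    case (Suc m)
    show ?case
    proof (cases t)
      case 0 then show ?thesis by simp
    next
      case (Suc u)
      then have "(\<Sum>i<m. 2 * int (u - i)) = int u * (int u + 1)" using Suc.IH[of u] Suc.prems by simp
      then show ?thesis unfolding sum.lessThan_Suc_shift using Suc by (simp add: algebra_simps)
    qed
  qed simp
  have "block_disc m m f = (\<Sum>i<m. 2 * int (t - i) - int m)"
    unfolding block_disc_def by (intro sum.cong refl row) simp
  then show ?thesis using tri[OF assms(2)] by (simp add: sum_subtractf)
qed

text \<open>
  The square through entries \<open>i\<close> and \<open>i'\<close> of column \<open>m + d\<close> has its left side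
  inside the corner square because \<open>i' - i > d\<close>. Its lower left corner is \<open>-1\<close>, and the
  condition on \<open>i\<close> and \<open>i'\<close> tells the sign of its upper left corner.
\<close>
lemma new_column:
  assumes sq: "square_free n n f" and p: "staircase m t f" and m: "m + d < n" "t \<le> m"
    and i: "i + d < i'" "i' < m"
  shows "2 * i + m + d < t + i' \<Longrightarrow> f i (m + d) = f i' (m + d)"
    "t + i' \<le> 2 * i + m + d \<Longrightarrow> \<not> (f i (m + d) \<and> f i' (m + d))"
proof -
  let ?j = "m + d - (i' - i)"
  have z: "\<not> zero_sum (f i ?j) (f i (m + d)) (f i' ?j) (f i' (m + d))"
    by (rule square_freeD[OF sq]) (use i m in auto)
  have j: "?j < m" "i + ?j = 2 * i + m + d - i'" "i' + ?j = i + m + d" using i by auto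
  then have "f i ?j = (2 * i + m + d < t + i')" "\<not> f i' ?j"
    using staircaseD[OF p, of i ?j] staircaseD[OF p, of i' ?j] i m by auto
  then show "2 * i + m + d < t + i' \<Longrightarrow> f i (m + d) = f i' (m + d)"
    "t + i' \<le> 2 * i + m + d \<Longrightarrow> \<not> (f i (m + d) \<and> f i' (m + d))"
    using z by (auto simp: zero_sum_iff)
qed

text \<open>
  The last of the \<open>m\<close> entries is \<open>-1\<close>, as in \<open>extend_step\<close>. Two entries 1 in positions \<open>i < i'\<close>
  must come from a square with upper left corner 1, but then entry \<open>i\<close> would also agree with the last
  entry. So at most one of the entries is 1.
\<close>
lemma first_column:
  assumes sq: "square_free n n f" and p: "staircase m t f" and m: "m < n" "t \<le> m" "4 \<le> t" "3 * t \<le> 2 * m + 1"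
  shows "block_disc m 1 (shift 0 m f) \<le> 2 - int m"
proof -
  note E = new_column(1)[OF sq p, of 0, simplified] and N = new_column(2)[OF sq p, of 0, simplified]
  have l: "\<not> f (m - 1) m"
    using E[of 0 "m - 1"] E[of 0 "m - 2"] N[of "m - 2" "m - 1"] m by auto
  have one: "i = i'" if "i < m" "i' < m" "f i m" "f i' m" for i i'
  proof (rule ccontr)
    have aux: False if "i < i'" "i' < m" "f i m" "f i' m" for i i'
      using E[of i "m - 1"] N[of i i'] l that m by (cases "2 * i + m < t + i'") auto
    assume "i \<noteq> i'" then show False using aux[of i i'] aux[of i' i] that by linarith
  qed
  have "card {i. i < m \<and> f i m} \<le> 1"
    by (rule card_le_Suc0_iff_eq[THEN iffD2, simplified One_nat_def[symmetric]]) (use one in auto)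
  moreover have "block_disc m 1 (shift 0 m f) = (\<Sum>i<m. sg (f i m))" by (simp add: block_disc_def shift_def)
  ultimately show ?thesis using sum_sg_card[of "\<lambda>i. f i m" m] by linarith
qed

text \<open>
  At most three of the \<open>m\<close> entries are 1. Let \<open>a\<close> be the position of the first one. Another one at
  distance at least 2 propagates to the last entry, and then only the last two positions are
  possible; so all positions are among \<open>a\<close>, \<open>a + 1\<close>, \<open>m - 2\<close> and \<open>m - 1\<close>. If all four occurred, the same
  propagation would also produce a 1 in position \<open>m - 3\<close>.
\<close>
lemma second_column:
  assumes sq: "square_free n n f" and p: "staircase m t f" and m: "m + 1 < n" "t \<le> m" "4 \<le> t" "3 * t \<le> 2 * m + 1"
  shows "block_disc m 1 (shift 0 (m + 1) f) \<le> 6 - int m"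
proof -
  let ?x = "\<lambda>i. f i (m + 1)"
  let ?S = "{i. i < m \<and> ?x i}"
  note E = new_column(1)[OF sq p, of 1] and N = new_column(2)[OF sq p, of 1]
  have "card ?S \<le> 3"
  proof (cases "?S = {}")
    case False
    define a where "a = (LEAST i. i \<in> ?S)"
    have a: "a < m" "?x a" using LeastI_ex[of "\<lambda>i. i \<in> ?S"] False unfolding a_def by auto
    have least: "a \<le> i" if "i < m" "?x i" for i using Least_le[of "\<lambda>i. i \<in> ?S" i] that unfolding a_def by auto
    have far: "c = m - 2 \<or> c = m - 1" if "c < m" "?x c" "a + 2 \<le> c" for c
    proof (rule ccontr)
      assume c: "\<not> (c = m - 2 \<or> c = m - 1)"
      have "2 * a + m + 1 < t + c" using N[of a c] a that m by force
      moreover from this have "?x (m - 1)" using E[of a "m - 1"] a that m by auto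
      moreover have "c + 1 < m - 1" using that c by linarith
      moreover have "t + (m - 1) \<le> 2 * c + m + 1" using \<open>2 * a + m + 1 < t + c\<close> that m by linarith
      ultimately show False using N[of c "m - 1"] that m by auto
    qed
    have "?S \<subseteq> {a, a + 1, m - 2, m - 1}" using least far by force
    moreover have "?S \<noteq> {a, a + 1, m - 2, m - 1}" if "card {a, a + 1, m - 2, m - 1} = 4"
    proof
      assume S: "?S = {a, a + 1, m - 2, m - 1}"
      have "distinct [a, a + 1, m - 2, m - 1]"
        by (rule card_distinct) (simp only: list.set that, simp)
      then have d: "a + 1 \<noteq> m - 2" "a + 1 \<noteq> m - 1" "a \<noteq> m - 1" "a \<noteq> m - 2" by simp_all
      have "a + 1 \<in> ?S" "m - 1 \<in> ?S" unfolding S by simp_all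
      then have x: "?x (a + 1)" "?x (m - 1)" "a + 1 < m" by simp_all
      have am: "a + 4 \<le> m" using d x(3) a by linarith
      have "2 * (a + 1) + m + 1 < t + (m - 1)"
        using N[of "a + 1" "m - 1"] x am m by force
      then have "?x (m - 3)" using E[of a "m - 3"] a am m by auto
      then show False using N[of "m - 3" "m - 1"] x am m by auto
    qed
    ultimately have "card ?S < 4"
    proof (cases "card {a, a + 1, m - 2, m - 1} = 4")
      case True
      then have "?S \<subset> {a, a + 1, m - 2, m - 1}"
        using \<open>?S \<subseteq> _\<close> \<open>_ \<Longrightarrow> ?S \<noteq> _\<close> by blast
      then show ?thesis using psubset_card_mono[of "{a, a + 1, m - 2, m - 1}" ?S] True by simp
    next
      case False
      have "card {a, a + 1, m - 2, m - 1} \<le> 4" by (simp add: card_insert_if)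
      then show ?thesis using False card_mono[OF _ \<open>?S \<subseteq> _\<close>] by simp
    qed
    then show ?thesis by simp
  next
    case True then show ?thesis by (simp only: card.empty)
  qed
  moreover have "block_disc m 1 (shift 0 (m + 1) f) = (\<Sum>i<m. sg (?x i))" by (simp add: block_disc_def shift_def)
  ultimately show ?thesis using sum_sg_card[of ?x m] by linarith
qed

text \<open>
  The corner square of size \<open>m = \<lfloor>3t/2\<rfloor>\<close> has discrepancy \<open>t * (t + 1) - m\<^sup>2 < - m\<^sup>2 / 4\<close>, and
  hooks can be added from there. The sizes \<open>m + 1\<close> and \<open>m + 2\<close> are reached by the bounds on
  new columns and rows, and \<open>m + 3\<close> by a hook around the square of size \<open>m - 1\<close>, which is also a
  staircase.
\<close>
lemma corner_bound:
  assumes f: "corner n k t f"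
  shows "4 * block_disc n n f < - (int n * int n)"
proof -
  define m where "m = 3 * t div 2"
  have t: "4 \<le> t" and mn: "m < n" and p: "staircase m t f" using corner_extend[OF f] by (auto simp: m_def)
  have sq: "square_free n n f" using f by (simp add: corner_def)
  have m: "t + 2 \<le> m" "3 * t \<le> 2 * m + 1" "6 \<le> m" using t by (auto simp: m_def)
  (* Writing t as 2 * u or 2 * u + 1 removes the rounding from m. *)
  obtain u where u: "t = 2 * u \<and> m = 3 * u \<or> t = 2 * u + 1 \<and> m = 3 * u + 1" "2 \<le> u"
  proof
    show "t = 2 * (t div 2) \<and> m = 3 * (t div 2) \<or> t = 2 * (t div 2) + 1 \<and> m = 3 * (t div 2) + 1"
      unfolding m_def by presburger
    show "2 \<le> t div 2" using t by linarith
  qed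
  have uu: "2 * int u \<le> int u * int u" using u(2) by (intro mult_right_mono) auto
  (* This says that the discrepancy of the corner square is below minus a quarter of its area. *)
  have key: "4 * (int t * (int t + 1)) < 3 * (int m * int m)"
    using u(1)
  proof (elim disjE conjE)
    assume "t = 2 * u" "m = 3 * u"
    then have "4 * (int t * (int t + 1)) = 16 * (int u * int u) + 8 * int u"
      "3 * (int m * int m) = 27 * (int u * int u)" by (simp_all add: algebra_simps)
    then show ?thesis using uu u(2) by linarith
  next
    assume "t = 2 * u + 1" "m = 3 * u + 1"
    then have "4 * (int t * (int t + 1)) = 16 * (int u * int u) + 24 * int u + 8"
      "3 * (int m * int m) = 27 * (int u * int u) + 18 * int u + 3" by (simp_all add: algebra_simps)
    then show ?thesis using uu u(2) by linarith
  qed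
  have bm: "block_disc m m f = int t * (int t + 1) - int m * int m" using block_disc_staircase[OF p] m by simp
  have nf: "negative_from b n f" if "m \<le> b + 1" for b
    using negative_outside[OF f] sq that m by (auto simp: negative_from_def)
  have p': "staircase m t (transposed f)" and sq': "square_free n n (transposed f)" using p square_free_transposed[OF sq] by (simp_all add: staircase_transposed)
  show ?thesis
  proof (rule ladder[of m])
    show "negative_from m n f" by (rule nf) simp
    show "5 \<le> m" "m \<le> n" using m mn by auto
    fix a assume a: "m \<le> a" "a < m + 4" "a \<le> n"
    then consider "a = m" | "a = m + 1" | "a = m + 2" | "a = m + 3" by linarith
    then show "4 * block_disc a a f < - (int a * int a)"
    proof cases
      case 1 then show ?thesis using bm key by simp
    next
      case 2
      have c: "block_disc m 1 (shift 0 m f) \<le> 2 - int m" by (rule first_column[OF sq p]) (use m mn t in auto)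
      have r: "block_disc 1 m (shift m 0 f) \<le> 2 - int m"
        using first_column[OF sq' p'] m mn t by (simp add: transposed_shift[symmetric] block_disc_transposed)
      have "block_disc 1 1 (shift m m f) \<le> 1" using block_disc_le[of 1 1] by fastforce
      then show ?thesis using c r block_disc_hook[of m 1 f] bm key m(3) 2 by (simp add: algebra_simps)
    next
      case 3
      have c: "block_disc m 2 (shift 0 m g) \<le> 8 - 2 * int m" if "square_free n n g" "staircase m t g" for g
      proof -
        have "block_disc m 1 (shift 0 m g) \<le> 2 - int m" by (rule first_column[OF that]) (use m mn t in auto)
        moreover have "block_disc m 1 (shift 0 (m + 1) g) \<le> 6 - int m"
          by (rule second_column[OF that]) (use m mn t a 3 in auto)
        ultimately show ?thesis
          using block_disc_cols[of m 1 1 "shift 0 m g"] by (simp add: shift_shift numeral_2_eq_2)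
      qed
      have r: "block_disc 2 m (shift m 0 f) \<le> 8 - 2 * int m"
        using c[OF sq' p'] by (simp add: transposed_shift[symmetric] block_disc_transposed)
      have "block_disc 2 2 (shift m m f) \<le> 4" using block_disc_le[of 2 2] by fastforce
      then have up: "block_disc a a f \<le> int t * (int t + 1) - int m * int m + 20 - 4 * int m"
        using c[OF sq p] r block_disc_hook[of m 2 f] bm 3 by simp
      have sqr: "int a * int a = int m * int m + 4 * int m + 4" using 3 by (simp add: algebra_simps)
      show ?thesis
      proof (cases "m = 6")
        case True
        then have "t = 4" using u by auto
        then show ?thesis using up True 3 by simp
      next
        case False
        then have "7 \<le> m" using m by simp
        then show ?thesis using up key sqr by linarith
      qed
    next
      case 4
      define b where "b = m - 1"
      have b: "m = b + 1" "a = b + 4" "5 \<le> b" "t \<le> b" using m 4 by (auto simp: b_def)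
      have bb: "block_disc b b f = int t * (int t + 1) - int b * int b"
        using block_disc_staircase[OF staircase_mono[OF p]] b by simp
      have h: "block_disc a a f \<le> block_disc b b f - 2 * strip b - 4"
        using hook[OF nf, of b] b a by simp
      show ?thesis
      (* For t = 4 and t = 5 the square of size b misses the bound of minus a quarter of its area,
         and the better bounds for strips of widths 5 and 6 make up for it. *)
      proof (cases "u = 2")
        case True
        then have "t = 4 \<and> b = 5 \<or> t = 5 \<and> b = 6" using u b by auto
        then show ?thesis using h bb b by (auto simp: strip_def)
      next
        case False
        then have "3 * int u \<le> int u * int u" using u(2) by (intro mult_right_mono) auto
        then have "4 * (int t * (int t + 1)) < 3 * (int b * int b)"
          using u(1)
        proof (elim disjE conjE)
          assume t': "t = 2 * u" and "m = 3 * u"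
          then have b': "int b = 3 * int u - 1" using b by simp
          have "4 * (int t * (int t + 1)) = 16 * (int u * int u) + 8 * int u"
            unfolding t' by (simp add: algebra_simps)
          moreover have "3 * (int b * int b) = 27 * (int u * int u) - 18 * int u + 3"
            unfolding b' by (simp add: algebra_simps)
          ultimately show ?thesis using \<open>3 * int u \<le> int u * int u\<close> u(2) by linarith
        next
          assume t': "t = 2 * u + 1" and "m = 3 * u + 1"
          then have b': "int b = 3 * int u" using b by simp
          have "4 * (int t * (int t + 1)) = 16 * (int u * int u) + 24 * int u + 8"
            unfolding t' by (simp add: algebra_simps)
          moreover have "3 * (int b * int b) = 27 * (int u * int u)"
            unfolding b' by (simp add: algebra_simps)
          ultimately show ?thesis using \<open>3 * int u \<le> int u * int u\<close> False u(2) by linarith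
        qed
        moreover have "strip b \<ge> int b" by (simp add: strip_def)
        ultimately show ?thesis using h bb b by (simp add: algebra_simps)
      qed
    qed
  qed
qed

text \<open>
  Moving a block by one step changes its discrepancy by at most 10, which is less than the gap
  between \<open>-7\<close> and 7.
\<close>
lemma negative_if_no_low:
  assumes sq: "square_free n n f" and high: "\<And>r c. r + 5 \<le> n \<Longrightarrow> c + 5 \<le> n \<Longrightarrow> 7 \<le> \<bar>block_disc 5 5 (shift r c f)\<bar>"
    and neg: "block_disc 5 5 f \<le> -7"
  shows "negative n n f"
proof -
  have slide: "block_disc 5 5 (shift (Suc r) c g) \<le> block_disc 5 5 (shift r c g) + 10" for r c g
    using block_disc_rows[of 1 4 5 "shift r c g"] block_disc_rows[of 4 1 5 "shift (Suc r) c g"]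
      block_disc_le[of 1 5 "negated (shift r c g)"] block_disc_le[of 1 5 "shift (Suc r + 4) c g"]
    by (simp add: shift_shift block_disc_negated)
  have slide': "block_disc 5 5 (shift r (Suc c) f) \<le> block_disc 5 5 (shift r c f) + 10" for r c
    using slide[of c r "transposed f"] by (simp add: transposed_shift[symmetric] block_disc_transposed)
  have col: "block_disc 5 5 (shift r 0 f) \<le> -7" if "r + 5 \<le> n" for r
    using that
  proof (induction r)
    case 0 then show ?case using neg by (simp add: shift_0)
  next
    case (Suc r) then show ?case using slide[of r 0 f] high[of "Suc r" 0] by fastforce
  qed
  have "block_disc 5 5 (shift r c f) \<le> -7" if "r + 5 \<le> n" "c + 5 \<le> n" for r c
    using that(2)
  proof (induction c)
    case 0 then show ?case using col that by simp
  next
    case (Suc c) then show ?case using slide'[of r c] high[of r "Suc c"] that(1) by fastforce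
  qed
  then show ?thesis using sq by (simp add: negative_def)
qed

section \<open>The discrepancy bound\<close>
lemma discrepancy_bound:
  assumes n: "5 \<le> n" and sq: "square_free n n f" and ns: "\<not> is_split n f"
  shows "int n * int n < 4 * \<bar>block_disc n n f\<bar>"
proof (cases "\<exists>r c. r + 5 \<le> n \<and> c + 5 \<le> n \<and> \<bar>block_disc 5 5 (shift r c f)\<bar> < 7")
  case True
  then obtain r c where rc: "r + 5 \<le> n" "c + 5 \<le> n" and low: "\<bar>block_disc 5 5 (shift r c f)\<bar> < 7" by blast
  let ?p = "\<lambda>h. staircase 5 4 h \<or> staircase 5 5 h"
  have "?p (shift r c f) \<or> ?p (shift r c (negated f)) \<or> ?p (shift r (n - 5 - c) (flip_cols n f))
      \<or> ?p (shift r (n - 5 - c) (negated (flip_cols n f)))"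
    by (rule low_block_staircase[OF sq rc low]) (rule refl)
  moreover have "n - 5 - c + 5 \<le> n" using rc(2) by simp
  ultimately obtain h c' where h: "h \<in> {f, negated f, flip_cols n f, negated (flip_cols n f)}" "c' + 5 \<le> n" "?p (shift r c' h)"
    using rc(2) by blast
  have "square_free n n (negated f)" "square_free n n (flip_cols n f)" "square_free n n (negated (flip_cols n f))"
    "\<not> is_split n (negated f)" "\<not> is_split n (flip_cols n f)" "\<not> is_split n (negated (flip_cols n f))"
    using sq ns square_free_negated square_free_flip_cols is_split_negated is_split_flip_cols by blast+
  then have "square_free n n h" "\<not> is_split n h" and bh: "\<bar>block_disc n n h\<bar> = \<bar>block_disc n n f\<bar>"
    using h(1) sq ns by (auto simp: block_disc_negated block_disc_flip_cols)
  from low_block_corner[OF this(1,2) rc(1) h(2,3)] obtain k t g where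
    "corner n k t g" "g = h \<or> g = negated (flip_rows n (flip_cols n h))" by blast
  then have "4 * block_disc n n g < - (int n * int n)" "\<bar>block_disc n n g\<bar> = \<bar>block_disc n n f\<bar>"
    using corner_bound bh by (auto simp: block_disc_negated block_disc_flip_cols block_disc_flip_rows)
  then show ?thesis by linarith
next
  case False
  then have high: "7 \<le> \<bar>block_disc 5 5 (shift r c f)\<bar>" if "r + 5 \<le> n" "c + 5 \<le> n" for r c
    using that by (meson not_less)
  have sh: "shift r c (negated f) = negated (shift r c f)" for r c by (simp add: shift_def negated_def)
  have "7 \<le> \<bar>block_disc 5 5 f\<bar>" using high[of 0 0] n by (simp add: shift_0)
  then consider "block_disc 5 5 f \<le> -7" | "block_disc 5 5 (negated f) \<le> -7" unfolding block_disc_negated by linarith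
  then have "negative n n f \<or> negative n n (negated f)"
  proof cases
    case 1 then show ?thesis using negative_if_no_low[OF sq high] by blast
  next
    case 2
    have "negative n n (negated f)" by (rule negative_if_no_low[OF square_free_negated[OF sq] _ 2]) (simp add: sh block_disc_negated high)
    then show ?thesis ..
  qed
  then show ?thesis using negative_bound[OF _ n, of f] negative_bound[OF _ n, of "negated f"] by (auto simp: block_disc_negated)
qed

text \<open>
  A staircase may have any \<open>t\<close>, whereas a split matrix needs \<open>t < 2 * n\<close>; from
  \<open>2 * n - 1\<close> on all patterns agree.
\<close>
lemma t_split_if_staircase:
  assumes N: "N \<in> carrier_mat n n" "\<And>i j. i < n \<Longrightarrow> j < n \<Longrightarrow> N $$ (i, j) = sg (g i j)"
    and n: "0 < n" and p: "staircase n t g"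
  shows "t_split (min t (2 * n - 1)) N"
  unfolding t_split_def
proof (intro conjI allI impI)
  show "min t (2 * n - 1) + 1 \<le> dim_row N + dim_col N" using N(1) n by auto
next
  fix i j assume ij: "i < dim_row N" "j < dim_col N"
  assume "i + 1 + (j + 1) \<le> min t (2 * n - 1) + 1"
  then show "N $$ (i, j) = 1" using N ij staircaseD[OF p, of i j] by (auto simp: sg_def)
next
  fix i j assume ij: "i < dim_row N" "j < dim_col N"
  assume "min t (2 * n - 1) + 2 \<le> i + 1 + (j + 1)"
  then show "N $$ (i, j) = -1" using N ij staircaseD[OF p, of i j] by (auto simp: sg_def min_def split: if_splits)
qed

theorem theorem2:
  fixes n :: nat and M :: "int mat"
  assumes "n \<ge> 5"
    and "M \<in> carrier_mat n n"
    and "elements_mat M \<subseteq> {-1, 1}"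
    and "\<not> split_mat M"
    and "real_of_int \<bar>disc M\<bar> \<le> (real n)\<^sup>2 / 4"
  shows "\<exists>i j s. zero_sum_square_at M i j s"
proof (rule ccontr)
  assume no: "\<nexists>i j s. zero_sum_square_at M i j s"
  define f where "f i j \<longleftrightarrow> M $$ (i, j) = 1" for i j
  have dim: "dim_row M = n" "dim_col M = n" using assms(2) by auto
  have M: "M $$ (i, j) = sg (f i j)" if "i < n" "j < n" for i j
  proof -
    have "M $$ (i, j) \<in> elements_mat M" by (rule elements_matI[OF assms(2) that refl])
    then show ?thesis using assms(3) by (auto simp: f_def sg_def)
  qed
  have "square_free n n f"
    unfolding square_free_def
  proof (intro allI impI)
    fix i j s assume "1 \<le> s \<and> i + s < n \<and> j + s < n"
    moreover have "\<not> zero_sum_square_at M i j s" using no by blast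
    ultimately show "\<not> zero_sum (f i j) (f i (j + s)) (f (i + s) j) (f (i + s) (j + s))"
      by (simp add: zero_sum_iff_sum zero_sum_square_at_def square_at_def dim M)
  qed
  moreover have "\<not> is_split n f"
  proof
    assume "is_split n f"
    then obtain t where t: "staircase n t f \<or> staircase n t (flip_rows n f) \<or> staircase n t (flip_cols n f) \<or> staircase n t (flip_rows n (flip_cols n f))"
      unfolding is_split_def by blast
    have n: "0 < n" using assms(1) by simp
    note split = t_split_if_staircase[OF _ _ n]
    have "\<exists>N\<in>{M, reverse_rows M, reverse_cols M, reverse_rows (reverse_cols M)}. t_split (min t (2 * n - 1)) N"
      using t
    proof (elim disjE)
      assume "staircase n t f"
      from split[OF assms(2) M this] show ?thesis by blast
    next
      assume "staircase n t (flip_rows n f)"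
      then have "t_split (min t (2 * n - 1)) (reverse_rows M)"
        by (rule split[rotated 2]) (auto simp: reverse_rows_def dim M flip_rows_def)
      then show ?thesis by blast
    next
      assume "staircase n t (flip_cols n f)"
      then have "t_split (min t (2 * n - 1)) (reverse_cols M)"
        by (rule split[rotated 2]) (auto simp: reverse_cols_def dim M flip_cols_def)
      then show ?thesis by blast
    next
      assume "staircase n t (flip_rows n (flip_cols n f))"
      then have "t_split (min t (2 * n - 1)) (reverse_rows (reverse_cols M))"
        by (rule split[rotated 2]) (auto simp: reverse_rows_def reverse_cols_def dim M flip_rows_def flip_cols_def)
      then show ?thesis by blast
    qed
    then show False using assms(4) unfolding split_mat_def by blast
  qed
  ultimately have "int n * int n < 4 * \<bar>block_disc n n f\<bar>" by (rule discrepancy_bound[OF assms(1)])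
  moreover have "disc M = block_disc n n f"
    by (simp add: disc_def block_disc_def dim M)
  ultimately have "int n * int n < 4 * \<bar>disc M\<bar>" by simp
  then have "real_of_int (int n * int n) < real_of_int (4 * \<bar>disc M\<bar>)" by (simp only: of_int_less_iff)
  then show False using assms(5) by (simp add: power2_eq_square)
qed

end
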